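(* Let $N$ be a composite number and let \[ \Delta:=\min\left\{\frac{(u-v)^2}{4\sqrt{N}}\,:\,(u,v)\in\mathbb{N}^2,\ N=uv,\ u\neq 1,\ v\neq 1\right\}. \] Then there exists a deterministic algorithm that computes a proper factor of $N$ using \[ \widetilde{O}\big(\Delta\cdot \exp(-C\log\Delta/\log\log\Delta)\big) \] bit operations, where $C=(1+o(1))\log 2$ and where factors that are polynomial in $\log N$ and $\log\Delta$ are ignored. The space complexity of this algorithm is negligible.
   Context: $\widetilde{O}$ denotes big-O notation ignoring factors polynomial in $\log N$ and $\log \Delta$. A proper factor of $N$ is a divisor $d$ with $1<d<N$. "Negligible space complexity" means that the algorithm only stores data of size polynomial in $\log N$ and $\log\Delta$ (in particular it does not store tables of candidate residues). *)

theory Defs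
  imports Complex_Main "HOL-Computational_Algebra.Primes" "HOL-Library.Log_Nat"
    "HOL-Library.Landau_Symbols"
begin

section \<open>Deterministic algorithms with bit cost\<close>

text \<open>
  Algorithms are while-programs over finitely many registers holding natural numbers, i.e.
  random access machines under the logarithmic cost criterion, without indirect addressing.
  Every step is charged for the bits of its operands: addition, subtraction, copying and testing
  linearly, multiplication and division at the schoolbook rate (product of the lengths).
  There are no arrays, so any table would have to be packed into registers and would be
  accounted for by the space measure.
\<close>

type_synonym reg = nat
type_synonym state = "reg \<Rightarrow> nat"

datatype arith = Add | Sub | Mul | Quot | Rem

datatype instr =
    Load reg nat
  | Copy reg reg
  | Arith reg arith reg reg

datatype prog =
    Instr instr
  | Seq prog prog
  | If_Nonzero reg prog prog
  | While_Nonzero reg prog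

text \<open>Number of binary digits; \<open>len 0 = 0\<close>.\<close>

abbreviation len :: "nat \<Rightarrow> nat" where
  "len n \<equiv> floorlog 2 n"

text \<open>\<^term>\<open>Sub\<close> truncates at 0; division by 0 follows the HOL convention.\<close>

fun arith_val :: "arith \<Rightarrow> nat \<Rightarrow> nat \<Rightarrow> nat" where
  "arith_val Add a b = a + b"
| "arith_val Sub a b = a - b"
| "arith_val Mul a b = a * b"
| "arith_val Quot a b = a div b"
| "arith_val Rem a b = a mod b"

fun arith_cost :: "arith \<Rightarrow> nat \<Rightarrow> nat \<Rightarrow> nat" where
  "arith_cost Add a b = 1 + len a + len b"
| "arith_cost Sub a b = 1 + len a + len b"
| "arith_cost Mul a b = (1 + len a) * (1 + len b)"
| "arith_cost Quot a b = (1 + len a) * (1 + len b)"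
| "arith_cost Rem a b = (1 + len a) * (1 + len b)"

fun instr_step :: "instr \<Rightarrow> state \<Rightarrow> state" where
  "instr_step (Load x n) s = s(x := n)"
| "instr_step (Copy x y) s = s(x := s y)"
| "instr_step (Arith x f y z) s = s(x := arith_val f (s y) (s z))"

fun instr_cost :: "instr \<Rightarrow> state \<Rightarrow> nat" where
  "instr_cost (Load x n) s = 1 + len n"
| "instr_cost (Copy x y) s = 1 + len (s y)"
| "instr_cost (Arith x f y z) s = arith_cost f (s y) (s z)"

fun instr_regs :: "instr \<Rightarrow> reg set" where
  "instr_regs (Load x n) = {x}"
| "instr_regs (Copy x y) = {x, y}"
| "instr_regs (Arith x f y z) = {x, y, z}"

fun regs :: "prog \<Rightarrow> reg set" where
  "regs (Instr i) = instr_regs i"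
| "regs (Seq p q) = regs p \<union> regs q"
| "regs (If_Nonzero r p q) = {r} \<union> regs p \<union> regs q"
| "regs (While_Nonzero r p) = {r} \<union> regs p"

definition mem_bits :: "reg set \<Rightarrow> state \<Rightarrow> nat" where
  "mem_bits R s = (\<Sum>r\<in>R. len (s r))"

text \<open>
  \<open>exec R p s t m s'\<close>: started in state \<open>s\<close>, the program \<open>p\<close> halts in state \<open>s'\<close> after \<open>t\<close> bit
  operations, and \<open>m\<close> is the maximum, over all states passed through, of the number of bits held
  in the registers \<open>R\<close>.
\<close>

inductive exec :: "reg set \<Rightarrow> prog \<Rightarrow> state \<Rightarrow> nat \<Rightarrow> nat \<Rightarrow> state \<Rightarrow> bool" for R where
  exec_Instr:
    "exec R (Instr i) s (instr_cost i s)
       (max (mem_bits R s) (mem_bits R (instr_step i s))) (instr_step i s)"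
| exec_Seq:
    "exec R p s t1 m1 s1 \<Longrightarrow> exec R q s1 t2 m2 s2 \<Longrightarrow>
     exec R (Seq p q) s (t1 + t2) (max m1 m2) s2"
| exec_If_True:
    "s r \<noteq> 0 \<Longrightarrow> exec R p s t m s' \<Longrightarrow>
     exec R (If_Nonzero r p q) s (1 + len (s r) + t) m s'"
| exec_If_False:
    "s r = 0 \<Longrightarrow> exec R q s t m s' \<Longrightarrow>
     exec R (If_Nonzero r p q) s (1 + len (s r) + t) m s'"
| exec_While_True:
    "s r \<noteq> 0 \<Longrightarrow> exec R p s t1 m1 s1 \<Longrightarrow> exec R (While_Nonzero r p) s1 t2 m2 s2 \<Longrightarrow>
     exec R (While_Nonzero r p) s (1 + len (s r) + t1 + t2) (max m1 m2) s2"
| exec_While_False: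
    "s r = 0 \<Longrightarrow> exec R (While_Nonzero r p) s (1 + len (s r)) (mem_bits R s) s"

inductive_cases exec_InstrE: "exec R (Instr i) s t m s'"
inductive_cases exec_SeqE: "exec R (Seq p q) s t m s'"
inductive_cases exec_IfE: "exec R (If_Nonzero r p q) s t m s'"
inductive_cases exec_WhileE: "exec R (While_Nonzero r p) s t m s'"

lemma exec_deterministic:
  "exec R p s t m s' \<Longrightarrow> exec R p s t2 m2 s2 \<Longrightarrow> t2 = t \<and> m2 = m \<and> s2 = s'"
proof (induction arbitrary: t2 m2 s2 rule: exec.induct)
  case (exec_Instr i s)
  then show ?case by (auto elim: exec_InstrE)
next
  case (exec_Seq p s t1 m1 s1 q t2' m2' s2')
  from exec_Seq.prems show ?case
  proof (rule exec_SeqE)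
    fix a b c d e
    assume *: "t2 = a + d" "m2 = max b e" "exec R p s a b c" "exec R q c d e s2"
    from exec_Seq.IH(1)[OF *(3)] have "a = t1" "b = m1" "c = s1" by simp_all
    with exec_Seq.IH(2)[of d e s2] * show ?thesis by simp
  qed
next
  case (exec_If_True s r p t m s' q)
  from exec_If_True.prems show ?case
  proof (rule exec_IfE)
    fix a
    assume *: "t2 = Suc (len (s r) + a)" "exec R p s a m2 s2"
    from exec_If_True.IH[OF *(2)] * show ?thesis by simp
  qed (use exec_If_True.hyps in simp)
next
  case (exec_If_False s r q t m s' p)
  from exec_If_False.prems show ?case
  proof (rule exec_IfE)
    fix a
    assume *: "t2 = Suc (len 0 + a)" "s r = 0" "exec R q s a m2 s2"
    from exec_If_False.IH[OF *(3)] * show ?thesis by simp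
  qed (use exec_If_False.hyps in simp)
next
  case (exec_While_True s r p t1 m1 s1 t2' m2' s2')
  from exec_While_True.prems show ?case
  proof (rule exec_WhileE)
    fix a b c d e
    assume *: "t2 = Suc (len (s r) + a + d)" "m2 = max b e"
      "exec R p s a b c" "exec R (While_Nonzero r p) c d e s2"
    from exec_While_True.IH(1)[OF *(3)] have "a = t1" "b = m1" "c = s1" by simp_all
    with exec_While_True.IH(2)[of d e s2] * show ?thesis by simp
  qed (use exec_While_True.hyps in simp)
next
  case (exec_While_False s r p)
  from exec_While_False.prems show ?case
    by (rule exec_WhileE) (use exec_While_False.hyps in auto)
qed

text \<open>Input and output are in register 0; all other registers are initially 0.\<close>

definition computes :: "prog \<Rightarrow> nat \<Rightarrow> nat \<Rightarrow> nat \<Rightarrow> nat \<Rightarrow> bool" where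
  "computes P x t m y \<longleftrightarrow>
     (\<exists>s. exec (insert 0 (regs P)) P (\<lambda>r. if r = 0 then x else 0) t m s \<and> s 0 = y)"

lemma finite_regs: "finite (regs P)"
proof (induction P)
  case (Instr i)
  then show ?case by (cases i) auto
qed auto

section \<open>Factorisations\<close>

definition composite :: "nat \<Rightarrow> bool" where
  "composite N \<longleftrightarrow> 1 < N \<and> \<not> prime N"

definition proper_factor :: "nat \<Rightarrow> nat \<Rightarrow> bool" where
  "proper_factor d N \<longleftrightarrow> d dvd N \<and> 1 < d \<and> d < N"

definition Delta_set :: "nat \<Rightarrow> real set" where
  "Delta_set N = {(real u - real v)\<^sup>2 / (4 * sqrt (real N)) | u v. N = u * v \<and> u \<noteq> 1 \<and> v \<noteq> 1}"

definition Delta :: "nat \<Rightarrow> real" where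
  "Delta N = Min (Delta_set N)"

lemma finite_Delta_set:
  assumes "0 < N"
  shows "finite (Delta_set N)"
proof (rule finite_subset)
  let ?g = "\<lambda>(u, v). (real u - real v)\<^sup>2 / (4 * sqrt (real N))"
  show "Delta_set N \<subseteq> ?g ` ({..N} \<times> {..N})"
  proof
    fix x
    assume "x \<in> Delta_set N"
    then obtain u v where x: "x = (real u - real v)\<^sup>2 / (4 * sqrt (real N))" and N: "N = u * v"
      unfolding Delta_set_def by blast
    from N assms have "u \<le> N" "v \<le> N" by auto
    then have "(u, v) \<in> {..N} \<times> {..N}" by simp
    moreover from x have "x = ?g (u, v)" by simp
    ultimately show "x \<in> ?g ` ({..N} \<times> {..N})" by blast
  qed
qed simp

lemma Delta_set_nonempty:
  assumes "composite N"
  shows "Delta_set N \<noteq> {}"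
proof -
  from assms have "1 < N" "\<not> prime N" by (auto simp: composite_def)
  then obtain u where u: "u dvd N" "u \<noteq> 1" "u \<noteq> N"
    by (auto simp: prime_nat_iff)
  then obtain v where v: "N = u * v" by blast
  with u have "v \<noteq> 1" by auto
  with u v show ?thesis unfolding Delta_set_def by blast
qed

section \<open>Asymptotics\<close>

text \<open>
  \<open>Delta N\<close> may be small, even 0 (for squares), where \<open>ln (ln (Delta N))\<close> makes no sense.
  Bounds are therefore expressed in the following quantity, which equals \<open>Delta N\<close> as soon as
  the latter is at least 16 (note \<open>ln (ln 16) > 1\<close>). In the remaining range of bounded
  \<open>Delta N\<close>, a bound up to polynomial factors is then one polynomial in \<open>ln N\<close>.
\<close>

definition Delta16 :: "nat \<Rightarrow> real" where
  "Delta16 N = max (Delta N) 16"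

text \<open>
  O-notation, uniform in all composite \<open>N\<close>, ignoring factors polynomial in \<open>ln N\<close> and
  \<open>ln (Delta16 N)\<close>. As both logarithms exceed 1 for composite \<open>N\<close>, every polynomial in them is
  dominated by a constant multiple of a power of their product.
\<close>

definition soft_O :: "(nat \<Rightarrow> real) \<Rightarrow> (nat \<Rightarrow> real) \<Rightarrow> bool" where
  "soft_O f g \<longleftrightarrow>
     (\<exists>K k. \<forall>N. composite N \<longrightarrow>
        \<bar>f N\<bar> \<le> K * (ln (real N) * ln (Delta16 N)) ^ k * \<bar>g N\<bar>)"

end

theory Submission imports Defs "HOL-Real_Asymp.Real_Asymp" begin

text \<open>
  If \<open>N = u v\<close> then \<open>S = u + v\<close> satisfies \<open>2 sqrt N \<le> S \<le> 2 sqrt N + Delta\<close>, and \<open>S\<^sup>2 - 4 N\<close> is a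
  square. Modulo an odd prime \<open>p\<close> not dividing \<open>N\<close>, this holds for only about half of the residues
  \<open>S\<close>: they have the form \<open>x + N / x\<close>, and \<open>x\<close> and \<open>N / x\<close> give the same \<open>S\<close>. Let \<open>s\<close> be \<open>2 sqrt N\<close>
  rounded up. For \<open>X = 2, 3, ...\<close> the algorithm enumerates the offsets \<open>T < M\<close>, where \<open>M\<close> is the
  product of the primes up to \<open>X\<close>, for which \<open>S = s + T\<close> passes this test at all these primes; it also
  checks whether \<open>X\<close> divides \<open>N\<close>. The residues of \<open>T\<close> are encoded by the mixed-radix digits of a
  single counter, so that nothing is tabulated.

  The search ends at the latest when \<open>M > Delta\<close>, after about \<open>M / 2 ^ \<pi>(X)\<close> candidates. From
  \<open>M \<le> X ^ \<pi>(X)\<close> and a Chebyshev bound, which gives \<open>ln X \<le> (1 + o(1)) ln (ln M)\<close>, one gets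
  \<open>\<pi>(X) \<ge> (1 + o(1)) ln M / ln (ln M)\<close>.
\<close>

section \<open>Executing straight-line code and loops\<close>

text \<open>Modulo a prime divisor of \<open>N\<close> the number \<open>S^2 - 4 N\<close> is always
  a square and the sieve gains nothing; the division test disposes of this case, since such a prime
  is itself a proper factor. As \<open>Delta\<close> is not known in advance, the rounds grow with
  \<open>X\<close>; \<open>codes\<close> is monotone, so all rounds together cost at most about
  \<open>X\<close> times the last one. The absence of tables is paid for by redoing the selection of
  residues for every counter value, which takes a number of steps cubic in \<open>X\<close>; this is
  affordable because \<open>X\<close> stays polylogarithmic in \<open>Delta16 N\<close>. The
  constant in the exponent is the delicate point. A bound \<open>X <= (ln D)^A\<close> would only
  give \<open>C\<close> about \<open>ln 2 / A\<close>, so \<open>X\<close> has to be nearly linear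
  in \<open>ln D\<close>. The constant in the Chebyshev bound is immaterial, because only
  \<open>ln X\<close> enters, where it is absorbed by the \<open>o(1)\<close>.\<close>

fun blk :: "instr list \<Rightarrow> prog" where
  "blk [] = Instr (Copy 0 0)"
| "blk [i] = Instr i"
| "blk (i # j # is) = Seq (Instr i) (blk (j # is))"

text \<open>
  \<open>n\<close> counts instructions and tests, each of which costs at most \<open>(1 + b)\<^sup>2\<close> while all registers
  stay below \<open>2 ^ b\<close>. This loses only a factor polynomial in the bit length.
\<close>

definition run :: "reg set \<Rightarrow> nat \<Rightarrow> prog \<Rightarrow> state \<Rightarrow> nat \<Rightarrow> state \<Rightarrow> bool" where
  "run R b p s n s' \<longleftrightarrow>
     (\<exists>t m. exec R p s t m s' \<and> t \<le> n * (1 + b)\<^sup>2 \<and> m \<le> card R * b)"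

lemma len_le_iff: "len n \<le> b \<longleftrightarrow> n < 2 ^ b"
  by (simp add: floorlog_le_iff)

lemma mem_bits_le:
  assumes "\<And>r. s r < 2 ^ b"
  shows "mem_bits R s \<le> card R * b"
  unfolding mem_bits_def using assms sum_bounded_above[of R "\<lambda>r. len (s r)" b]
  by (simp add: len_le_iff)

lemma run_mono:
  assumes "run R b p s n s'" "n \<le> n'"
  shows "run R b p s n' s'"
  using assms unfolding run_def by (meson le_trans mult_le_mono1)

lemma run_mono_bits:
  assumes "run R b p s n s'" "b \<le> b'"
  shows "run R b' p s n s'"
proof -
  from assms(1) obtain t m where *: "exec R p s t m s'" "t \<le> n * (1 + b)\<^sup>2" "m \<le> card R * b"
    unfolding run_def by blast
  have "n * (1 + b)\<^sup>2 \<le> n * (1 + b')\<^sup>2" "card R * b \<le> card R * b'"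
    using assms(2) by (simp_all add: power_mono)
  with * show ?thesis unfolding run_def by (meson le_trans)
qed

lemma run_Seq:
  assumes "run R b p s n1 s1" "run R b q s1 n2 s2"
  shows "run R b (Seq p q) s (n1 + n2) s2"
proof -
  from assms obtain t1 m1 t2 m2 where
    "exec R p s t1 m1 s1" "t1 \<le> n1 * (1 + b)\<^sup>2" "m1 \<le> card R * b"
    "exec R q s1 t2 m2 s2" "t2 \<le> n2 * (1 + b)\<^sup>2" "m2 \<le> card R * b"
    unfolding run_def by blast
  then have "exec R (Seq p q) s (t1 + t2) (max m1 m2) s2"
    "t1 + t2 \<le> (n1 + n2) * (1 + b)\<^sup>2" "max m1 m2 \<le> card R * b"
    by (auto intro: exec_Seq simp: add_mult_distrib)
  then show ?thesis unfolding run_def by blast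
qed

lemma run_While_False:
  assumes "s r = 0" "\<And>r. s r < 2 ^ b"
  shows "run R b (While_Nonzero r p) s 1 s"
proof -
  have "exec R (While_Nonzero r p) s (1 + len (s r)) (mem_bits R s) s"
    using assms(1) by (rule exec_While_False)
  moreover have "1 + len (s r) \<le> 1 * (1 + b)\<^sup>2" using assms(1) by (simp add: floorlog_def)
  ultimately show ?thesis
    unfolding run_def using mem_bits_le[of s b R, OF assms(2)] by blast
qed

lemma test_cost: "x < 2 ^ b \<Longrightarrow> 1 + len x \<le> (1 + b)\<^sup>2"
  using len_le_iff[of x b] by (simp add: power2_eq_square)

lemma run_While_True:
  assumes "s r \<noteq> 0" "s r < 2 ^ b" "run R b p s n1 s1" "run R b (While_Nonzero r p) s1 n2 s2"
  shows "run R b (While_Nonzero r p) s (1 + n1 + n2) s2"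
proof -
  from assms(3,4) obtain t1 m1 t2 m2 where
    *: "exec R p s t1 m1 s1" "t1 \<le> n1 * (1 + b)\<^sup>2" "m1 \<le> card R * b"
    "exec R (While_Nonzero r p) s1 t2 m2 s2" "t2 \<le> n2 * (1 + b)\<^sup>2" "m2 \<le> card R * b"
    unfolding run_def by blast
  have "1 + len (s r) + t1 + t2 \<le> (1 + b)\<^sup>2 + n1 * (1 + b)\<^sup>2 + n2 * (1 + b)\<^sup>2"
    using test_cost[OF assms(2)] * by linarith
  also have "\<dots> = (1 + n1 + n2) * (1 + b)\<^sup>2" by (simp add: add_mult_distrib)
  finally show ?thesis
    unfolding run_def using exec_While_True[OF assms(1) *(1,4)] * by fastforce
qed

text \<open>A loop is described by its explicit sequence of states instead of an invariant, so the
  final state and the number of passes come out together. In the count, \<open>m + 1\<close>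
  includes the test before each pass, and the last 1 is the failing test.\<close>

lemma run_While_seq:
  fixes \<sigma> :: "nat \<Rightarrow> state"
  assumes "k \<le> n"
    and "\<And>i. k \<le> i \<Longrightarrow> i < n \<Longrightarrow> \<sigma> i r \<noteq> 0" "\<And>i. k \<le> i \<Longrightarrow> i < n \<Longrightarrow> \<sigma> i r < 2 ^ b"
    and "\<And>i. k \<le> i \<Longrightarrow> i < n \<Longrightarrow> run R b p (\<sigma> i) m (\<sigma> (Suc i))"
    and "\<sigma> n r = 0" "\<And>r. \<sigma> n r < 2 ^ b"
  shows "run R b (While_Nonzero r p) (\<sigma> k) ((n - k) * (m + 1) + 1) (\<sigma> n)"
  using assms
proof (induction k rule: inc_induct)
  case base
  then show ?case using run_While_False[of "\<sigma> n" r b R p] by simp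
next
  case (step k)
  have "run R b (While_Nonzero r p) (\<sigma> (Suc k)) ((n - Suc k) * (m + 1) + 1) (\<sigma> n)"
    using step by simp
  with step have "run R b (While_Nonzero r p) (\<sigma> k) (1 + m + ((n - Suc k) * (m + 1) + 1)) (\<sigma> n)"
    by (intro run_While_True[where ?s1.0 = "\<sigma> (Suc k)"]) auto
  moreover have "1 + m + ((n - Suc k) * (m + 1) + 1) = (n - k) * (m + 1) + 1"
  proof -
    have "n - k = Suc (n - Suc k)" using step by simp
    then show ?thesis by simp
  qed
  ultimately show ?case by simp
qed

text \<open>Constants up to 2 fit into any \<open>b >= 2\<close> bits, so one bit bound serves all
  instructions; the blocks obtain 4 as \<open>2 + 2\<close>.\<close>

fun small_load :: "instr \<Rightarrow> bool" where
  "small_load (Load x n) \<longleftrightarrow> n \<le> 2"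
| "small_load _ \<longleftrightarrow> True"

lemma instr_step_less:
  assumes "\<And>r. s r < 2 ^ b" "2 \<le> b" "small_load i"
  shows "instr_step i s r < 2 ^ (2 * b)"
proof -
  have le: "s y < 2 ^ (2 * b)" for y
    using assms(1)[of y] power_increasing[of b "2 * b" "2::nat"] by linarith
  have four: "(4::nat) \<le> 2 ^ (2 * b)"
    using assms(2) power_increasing[of 2 "2 * b" "2::nat"] by simp
  show ?thesis
  proof (cases i)
    case (Arith x f y z)
    have "s y + s z < 2 * 2 ^ b" using assms(1)[of y] assms(1)[of z] by simp
    also have "(2::nat) * 2 ^ b \<le> 2 ^ (2 * b)"
      using assms(2) power_increasing[of "Suc b" "2 * b" "2::nat"] by simp
    finally have "s y + s z < 2 ^ (2 * b)" .
    moreover have "s y * s z < 2 ^ b * 2 ^ b" by (intro mult_strict_mono assms(1)) auto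
    then have "s y * s z < 2 ^ (2 * b)" by (simp add: power_add[symmetric] mult_2)
    moreover have "s y div s z < 2 ^ (2 * b)" "s y mod s z < 2 ^ (2 * b)"
      by (rule le_less_trans[OF _ le[of y]], simp)+
    ultimately have "arith_val f (s y) (s z) < 2 ^ (2 * b)"
      using le[of y] by (cases f) auto
    with le show ?thesis by (simp add: Arith)
  qed (use le assms four in \<open>auto intro: le_less_trans\<close>)
qed

lemma run_Instr:
  assumes "\<And>r. s r < 2 ^ b" "2 \<le> b" "small_load i"
  shows "run R (2 * b) (Instr i) s 1 (instr_step i s)"
proof -
  have l: "len (s r) \<le> b" for r using assms(1) by (simp add: len_le_iff)
  have "instr_cost i s \<le> (1 + 2 * b)\<^sup>2"
  proof (cases i)
    case (Load x n)
    then have "len n \<le> b" using assms power_increasing[of 2 b "2::nat"] by (simp add: len_le_iff)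
    with Load show ?thesis by (simp add: power2_eq_square)
  next
    case (Copy x y)
    with l[of y] show ?thesis by (simp add: power2_eq_square)
  next
    case (Arith x f y z)
    have "(1 + len (s y)) * (1 + len (s z)) \<le> (1 + 2 * b) * (1 + 2 * b)"
      using l[of y] l[of z] by (intro mult_mono) auto
    moreover have "1 + len (s y) + len (s z) \<le> (1 + 2 * b) * (1 + 2 * b)"
      using l[of y] l[of z] by simp
    ultimately show ?thesis using Arith by (cases f) (simp_all add: power2_eq_square)
  qed
  moreover have "s r < 2 ^ (2 * b)" for r
    using assms(1)[of r] power_increasing[of b "2 * b" "2::nat"] by linarith
  then have "mem_bits R s \<le> card R * (2 * b)" by (rule mem_bits_le)
  moreover have "mem_bits R (instr_step i s) \<le> card R * (2 * b)"
    by (rule mem_bits_le) (rule instr_step_less[OF assms])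
  ultimately show ?thesis
    unfolding run_def using exec_Instr[of R i s] by (intro exI conjI) (assumption, auto)
qed

lemma run_blk_exact:
  assumes "\<And>r. s r < 2 ^ b" "2 \<le> b" "list_all small_load is" "is \<noteq> []"
  shows "run R (b * 2 ^ length is) (blk is) s (length is) (fold instr_step is s)"
  using assms
proof (induction "is" arbitrary: s b rule: blk.induct)
  case (2 i)
  then show ?case using run_Instr[of s b i R] by (simp add: mult.commute)
next
  case (3 i j "is")
  let ?b = "b * 2 ^ length (i # j # is)"
  have "run R (2 * b) (Instr i) s 1 (instr_step i s)" using 3 by (intro run_Instr) auto
  then have "run R ?b (Instr i) s 1 (instr_step i s)"
    by (rule run_mono_bits) (simp add: mult.assoc)
  moreover have "run R (2 * b * 2 ^ length (j # is)) (blk (j # is)) (instr_step i s)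
      (length (j # is)) (fold instr_step (j # is) (instr_step i s))"
    using 3 instr_step_less[of s b i] by (intro "3.IH") auto
  moreover have "2 * b * 2 ^ length (j # is) = ?b" by simp
  ultimately have "run R ?b (Seq (Instr i) (blk (j # is))) s (1 + length (j # is))
      (fold instr_step (j # is) (instr_step i s))"
    by (metis run_Seq)
  then show ?case by simp
qed simp

section \<open>Symbolic execution on finite register lists\<close>

definition st :: "nat list \<Rightarrow> state" where
  "st xs r = (if r < length xs then xs ! r else 0)"

fun lstep :: "instr \<Rightarrow> nat list \<Rightarrow> nat list" where
  "lstep (Load x n) xs = xs[x := n]"
| "lstep (Copy x y) xs = xs[x := xs ! y]"
| "lstep (Arith x f y z) xs = xs[x := arith_val f (xs ! y) (xs ! z)]"

text \<open>Updating a list outside its range silently does nothing, so \<open>lstep\<close> mirrors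
  \<open>instr_step\<close> only for registers inside the list.\<close>

definition fits :: "nat \<Rightarrow> instr \<Rightarrow> bool" where
  "fits n i \<longleftrightarrow> small_load i \<and> (\<forall>r\<in>instr_regs i. r < n)"

lemma instr_step_st: "fits (length xs) i \<Longrightarrow> instr_step i (st xs) = st (lstep i xs)"
  by (cases i) (auto simp: st_def fits_def fun_eq_iff nth_list_update)

lemma length_lstep [simp]: "length (lstep i xs) = length xs"
  by (cases i) auto

lemma fold_instr_step_st:
  "list_all (fits (length xs)) is \<Longrightarrow> fold instr_step is (st xs) = st (fold lstep is xs)"
  by (induction "is" arbitrary: xs) (auto simp: instr_step_st)

lemma st_less: "\<forall>x\<in>set xs. x < 2 ^ b \<Longrightarrow> st xs r < 2 ^ b"
  by (auto simp: st_def)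

text \<open>
  One instruction at most doubles the bit lengths, so a block of at most 29 instructions that starts
  with \<open>b\<close>-bit registers stays within \<open>wide b\<close> bits. Bounds on the contents of registers are
  therefore only needed between blocks.
\<close>

definition wide :: "nat \<Rightarrow> nat" where
  "wide b = b * 2 ^ 29"

lemma le_wide: "b \<le> wide b"
  by (simp add: wide_def)

lemma less_wide: "x < 2 ^ b \<Longrightarrow> x < (2::nat) ^ wide b"
  by (rule less_le_trans[OF _ power_increasing[OF le_wide]]) auto

definition straight :: "instr list \<Rightarrow> bool" where
  "straight is \<longleftrightarrow> list_all (fits 29) is \<and> is \<noteq> [] \<and> length is \<le> 29"

lemma run_blk:
  assumes "straight is" "2 \<le> b" "fold lstep is xs = ys" "length xs = 29" "\<forall>x\<in>set xs. x < 2 ^ b"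
  shows "run R (wide b) (blk is) (st xs) 29 (st ys)"
proof -
  have "list_all small_load is" using assms(1) by (auto simp: straight_def list_all_iff fits_def)
  have "run R (b * 2 ^ length is) (blk is) (st xs) (length is) (fold instr_step is (st xs))"
    by (rule run_blk_exact)
      (use assms(1,2) st_less[OF assms(5)] \<open>list_all small_load is\<close> in \<open>auto simp: straight_def\<close>)
  then have *: "run R (b * 2 ^ length is) (blk is) (st xs) (length is) (st ys)"
    using fold_instr_step_st[of xs "is"] assms by (simp add: straight_def)
  have "b * 2 ^ length is \<le> wide b"
    unfolding wide_def using assms(1) by (intro mult_le_mono2 power_increasing) (auto simp: straight_def)
  then show ?thesis using * assms(1) by (auto simp: straight_def intro: run_mono run_mono_bits)
qed

lemma run_While_st:
  fixes \<sigma> :: "nat \<Rightarrow> nat list"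
  assumes "\<And>i. i \<le> n \<Longrightarrow> \<forall>x\<in>set (\<sigma> i). x < 2 ^ b"
    and "\<And>i. i \<le> n \<Longrightarrow> r < length (\<sigma> i)"
    and "\<And>i. i < n \<Longrightarrow> \<sigma> i ! r \<noteq> 0" "\<sigma> n ! r = 0"
    and "\<And>i. i < n \<Longrightarrow> run R (wide b) p (st (\<sigma> i)) m (st (\<sigma> (Suc i)))"
  shows "run R (wide b) (While_Nonzero r p) (st (\<sigma> 0)) (n * (m + 1) + 1) (st (\<sigma> n))"
proof -
  have "st (\<sigma> i) r' < 2 ^ wide b" if "i \<le> n" for i r'
    by (rule less_wide[OF st_less[OF assms(1)[OF that]]])
  moreover have "st (\<sigma> i) r = \<sigma> i ! r" if "i \<le> n" for i
    using assms(2)[OF that] by (simp add: st_def)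
  ultimately have "\<And>i. i < n \<Longrightarrow> st (\<sigma> i) r \<noteq> 0" "\<And>i. i < n \<Longrightarrow> st (\<sigma> i) r < 2 ^ wide b"
    "st (\<sigma> n) r = 0" "\<And>r'. st (\<sigma> n) r' < 2 ^ wide b"
    using assms(3,4) by (metis less_imp_le order_refl)+
  with assms(5)
  have "run R (wide b) (While_Nonzero r p) (st (\<sigma> 0)) ((n - 0) * (m + 1) + 1) (st (\<sigma> n))"
    by (intro run_While_seq) auto
  then show ?thesis by simp
qed

lemma run_While_False_st:
  assumes "\<forall>x\<in>set xs. x < 2 ^ b" "r < length xs" "xs ! r = 0"
  shows "run R (wide b) (While_Nonzero r p) (st xs) 1 (st xs)"
  by (rule run_While_False[OF _ less_wide[OF st_less[OF assms(1)]]]) (simp add: st_def assms)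

lemma run_While_True_st:
  assumes "\<forall>x\<in>set xs. x < 2 ^ b" "r < length xs" "xs ! r \<noteq> 0"
    and "run R (wide b) p (st xs) n1 s1" "run R (wide b) (While_Nonzero r p) s1 n2 s2"
  shows "run R (wide b) (While_Nonzero r p) (st xs) (1 + n1 + n2) s2"
  by (rule run_While_True[OF _ less_wide[OF st_less[OF assms(1)]] assms(4,5)])
    (simp add: st_def assms)

lemma nth_numeral: "(x # xs) ! numeral k = xs ! pred_numeral k"
  by (simp add: numeral_eq_Suc)

lemma list_update_numeral: "(x # xs)[numeral k := y] = x # xs[pred_numeral k := y]"
  by (simp add: numeral_eq_Suc)

lemma nth_one: "(x # xs) ! 1 = xs ! 0"
  by simp

lemma list_update_one: "(x # xs)[1 := y] = x # xs[0 := y]"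
  by simp

lemmas step_simps = fold_simps lstep.simps arith_val.simps nth_numeral nth_one nth_Cons_0 nth_Cons_Suc
  list_update_numeral list_update_one list_update_code pred_numeral_simps BitM.simps

section \<open>The factoring program\<close>

text \<open>
  Register usage: 0 input and output, 1 search loop flag, 2 \<open>X\<close>, 3 counter, 4 \<open>s\<close>, 5 candidate factor;
  6 levels left, 7 \<open>p\<close>, 8 \<open>((p - 1)!)\<^sup>2\<close>, 9 product \<open>M\<close> of the primes below \<open>p\<close>, 10 remaining digits, 11 \<open>T\<close>;
  12 \<open>p\<close> if it is prime, else 1, 13 current digit, 14 loop variable, 15 number of hits, 16 new \<open>T\<close>,
  17 residue under test, 18 candidate square root, 19 zero iff a root was found, 20 \<open>S\<^sup>2 - 4 N\<close>;
  21 to 23 integer square root; 24 to 26 temporaries; 27 and 28 the constants 1 and 2.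
  Temporaries are reset to 0, which makes the states between blocks explicit. Conditionals are
  replaced by arithmetic with the indicator \<open>1 - x\<close> of \<open>x = 0\<close>.
\<close>

definition isqrt_body :: "instr list" where
  "isqrt_body = [
     Arith 24 Add 23 27, Arith 24 Quot 24 28, Arith 25 Add 22 24, Arith 26 Mul 25 25,
     Arith 26 Sub 26 21, Arith 26 Sub 27 26, Arith 26 Mul 26 24, Arith 22 Add 22 26,
     Arith 23 Quot 23 28, Load 24 0, Load 25 0, Load 26 0]"

definition isqrt_prog :: prog where
  "isqrt_prog = While_Nonzero 23 (blk isqrt_body)"

text \<open>Register 18 runs downwards through the trial roots. Register 19 starts at 1, and
  truncated subtraction keeps it at 0 once a root has been met.\<close>

definition root_body :: "instr list" where
  "root_body = [
     Arith 18 Sub 18 27, Arith 24 Sub 12 27, Arith 24 Mul 24 18, Arith 24 Mul 24 18,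
     Arith 24 Add 24 20, Arith 24 Rem 24 12, Arith 24 Sub 27 24, Arith 19 Sub 19 24, Load 24 0]"

definition sel_init :: "instr list" where
  "sel_init = [
     Arith 14 Sub 14 27, Arith 17 Mul 14 9, Arith 17 Add 17 11, Arith 20 Add 4 17,
     Arith 20 Mul 20 20, Arith 24 Add 28 28, Arith 24 Mul 24 0, Arith 20 Sub 20 24,
     Arith 20 Rem 20 12, Copy 18 12, Load 19 1, Load 24 0]"

text \<open>The two truncated differences of registers 13 and 15 add up to the distance between
  digit and hit count, so the indicator of this sum detects equality. The comparison precedes the
  increment of register 15: a digit counts the admissible residues above the selected one.\<close>

definition sel_final :: "instr list" where
  "sel_final = [
     Arith 24 Sub 27 19, Arith 25 Sub 15 13, Arith 26 Sub 13 15, Arith 25 Add 25 26,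
     Arith 25 Sub 27 25, Arith 25 Mul 25 24, Arith 25 Mul 25 17, Arith 16 Add 16 25,
     Arith 15 Add 15 24, Load 17 0, Load 19 0, Load 20 0, Load 24 0, Load 25 0, Load 26 0]"

definition sel_body :: prog where
  "sel_body = Seq (blk sel_init) (Seq (While_Nonzero 18 (blk root_body)) (blk sel_final))"

text \<open>The double complement \<open>1 - (1 - x)\<close> indicates that \<open>x\<close> is
  nonzero; applied to \<open>((p - 1)!)^2 mod p\<close> it singles out the primes.\<close>

definition level_init :: "instr list" where
  "level_init = [
     Arith 24 Rem 8 7, Arith 24 Sub 27 24, Arith 24 Sub 27 24, Arith 25 Sub 7 27,
     Arith 12 Mul 24 25, Arith 12 Add 12 27, Arith 24 Quot 12 28, Arith 24 Add 24 27,
     Arith 13 Rem 10 24, Arith 10 Quot 10 24, Copy 14 12, Load 24 0, Load 25 0]"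

definition level_final :: "instr list" where
  "level_final = [
     Copy 11 16, Arith 9 Mul 9 12, Arith 8 Mul 8 7, Arith 8 Mul 8 7, Arith 7 Add 7 27,
     Arith 6 Sub 6 27, Load 12 0, Load 13 0, Load 15 0, Load 16 0]"

definition level_body :: prog where
  "level_body = Seq (blk level_init) (Seq (While_Nonzero 14 sel_body) (blk level_final))"

definition cand_init :: "instr list" where
  "cand_init = [Copy 6 2, Load 7 1, Load 8 1, Load 9 1, Copy 10 3, Load 11 0]"

definition cand_test :: "instr list" where
  "cand_test = [
     Arith 24 Add 4 11, Arith 21 Mul 24 24, Arith 25 Add 28 28, Arith 25 Mul 25 0,
     Arith 21 Sub 21 25, Copy 23 21, Load 24 0, Load 25 0]"

definition cand_final :: "instr list" where
  "cand_final = [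
     Arith 5 Add 4 11, Arith 5 Sub 5 22, Arith 5 Quot 5 28,
     Arith 24 Rem 0 2, Arith 24 Sub 27 24, Arith 25 Sub 27 24, Arith 5 Mul 5 25,
     Arith 24 Mul 24 2, Arith 5 Add 5 24,
     Arith 1 Rem 0 5, Arith 24 Sub 28 5, Arith 1 Add 1 24, Arith 24 Add 5 27,
     Arith 24 Sub 24 0, Arith 1 Add 1 24,
     Arith 24 Sub 27 10, Arith 25 Sub 27 24, Arith 2 Add 2 25, Arith 3 Add 3 27,
     Arith 3 Mul 3 24,
     Load 7 0, Load 8 0, Load 9 0, Load 10 0, Load 11 0, Load 21 0, Load 22 0, Load 24 0,
     Load 25 0]"

definition cand_body :: prog where
  "cand_body = Seq (blk cand_init) (Seq (While_Nonzero 6 level_body)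
     (Seq (blk cand_test) (Seq isqrt_prog (blk cand_final))))"

text \<open>For \<open>N > 0\<close>, \<open>isqrt (4 * N - 1) + 1\<close> is
  \<open>2 sqrt N\<close> rounded up, also when \<open>4 N\<close> is a square.\<close>

definition prog_init :: "instr list" where
  "prog_init = [Load 27 1, Load 28 2, Arith 21 Add 28 28, Arith 21 Mul 21 0, Arith 21 Sub 21 27, Copy 23 21]"

definition prog_start :: "instr list" where
  "prog_start = [Arith 4 Add 22 27, Load 1 1, Load 2 2, Load 21 0, Load 22 0]"

definition factor_prog :: prog where
  "factor_prog = Seq (blk prog_init) (Seq isqrt_prog (Seq (blk prog_start)
     (Seq (While_Nonzero 1 cand_body) (Instr (Copy 0 5)))))"

section \<open>Integer square root by bisection\<close>

function bisect :: "nat \<Rightarrow> nat \<Rightarrow> nat \<Rightarrow> nat" where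
  "bisect n lo t = (if t = 0 then lo else
     bisect n (lo + (if (lo + (t + 1) div 2)\<^sup>2 \<le> n then (t + 1) div 2 else 0)) (t div 2))"
  by auto
termination by (relation "measure (\<lambda>(n, lo, t). t)") auto

declare bisect.simps [simp del]

lemma bisect_0 [simp]: "bisect n lo 0 = lo"
  by (subst bisect.simps) simp

text \<open>The root lies between \<open>lo\<close> and \<open>lo + t\<close>. With the probe at
  offset \<open>(t + 1) div 2\<close>, either outcome leaves it in an interval of length
  \<open>t div 2\<close>, so the number of passes is the bit length of the initial \<open>t\<close>
  for every \<open>n\<close>.\<close>

lemma bisect_correct:
  "lo\<^sup>2 \<le> n \<Longrightarrow> n < (lo + t + 1)\<^sup>2 \<Longrightarrow> (bisect n lo t)\<^sup>2 \<le> n \<and> n < (bisect n lo t + 1)\<^sup>2"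
proof (induction n lo t rule: bisect.induct)
  case (1 n lo t)
  define h where "h = (t + 1) div 2"
  have t: "t = t div 2 + h" by (simp add: h_def)
  show ?case
  proof (cases "t = 0")
    case False
    show ?thesis
    proof (cases "(lo + h)\<^sup>2 \<le> n")
      case True
      have "n < (lo + h + t div 2 + 1)\<^sup>2" using 1(3) t by (metis add.assoc add.commute)
      with True False 1(1) show ?thesis by (subst (1 2) bisect.simps) (simp add: h_def)
    next
      case F: False
      have "(lo + h)\<^sup>2 \<le> (lo + t div 2 + 1)\<^sup>2"
        by (rule power_mono) (auto simp: h_def)
      with F have "n < (lo + t div 2 + 1)\<^sup>2" by linarith
      with F False 1(1,2) show ?thesis by (subst (1 2) bisect.simps) (simp add: h_def)
    qed
  qed (use 1 in simp)
qed

definition isqrt :: "nat \<Rightarrow> nat" where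
  "isqrt n = bisect n 0 n"

lemma isqrt_bounds: "(isqrt n)\<^sup>2 \<le> n" "n < (isqrt n + 1)\<^sup>2"
  using bisect_correct[of 0 n n] by (auto simp: isqrt_def power2_eq_square)

lemma isqrt_square: "isqrt (d\<^sup>2) = d"
proof -
  have "isqrt (d\<^sup>2) \<le> d" using isqrt_bounds(1)[of "d\<^sup>2"] by simp
  moreover have "d < isqrt (d\<^sup>2) + 1"
    using isqrt_bounds(2)[of "d\<^sup>2"] by (rule power_less_imp_less_base) simp
  ultimately show ?thesis by simp
qed

lemma straight_blocks:
  "straight isqrt_body" "straight root_body" "straight sel_init" "straight sel_final"
  "straight level_init" "straight level_final" "straight cand_init" "straight cand_test"
  "straight cand_final" "straight prog_init" "straight prog_start"
  by (simp_all add: straight_def fits_def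
    isqrt_body_def root_body_def sel_init_def sel_final_def level_init_def
    level_final_def cand_init_def cand_test_def cand_final_def prog_init_def
    prog_start_def)

lemma run_isqrt_body:
  assumes "\<forall>x\<in>set [r0,r1,r2,r3,r4,r5,r6,r7,r8,r9,r10,r11,r12,r13,r14,r15,r16,r17,r18,r19,r20,
      n,lo,t,0,0,0,1,2]. x < 2 ^ b" "2 \<le> b"
  shows "run R (wide b) (blk isqrt_body)
     (st [r0,r1,r2,r3,r4,r5,r6,r7,r8,r9,r10,r11,r12,r13,r14,r15,r16,r17,r18,r19,r20,n,lo,t,
       0,0,0,1,2])
     29 (st [r0,r1,r2,r3,r4,r5,r6,r7,r8,r9,r10,r11,r12,r13,r14,r15,r16,r17,r18,r19,r20,n,
       lo + (if (lo + (t + 1) div 2)\<^sup>2 \<le> n then (t + 1) div 2 else 0),t div 2,0,0,0,1,2])"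
proof -
  have lo: "lo + (if (lo + (t + 1) div 2)\<^sup>2 \<le> n then (t + 1) div 2 else 0) =
     lo + (1 - ((lo + (t + 1) div 2) * (lo + (t + 1) div 2) - n)) * ((t + 1) div 2)"
    by (simp add: power2_eq_square)
  show ?thesis
    unfolding lo
    by (rule run_blk[OF straight_blocks(1) assms(2) _ _ assms(1)])
      (simp_all only: isqrt_body_def step_simps, simp)
qed

lemma run_isqrt_aux:
  assumes "\<forall>x\<in>set [r0,r1,r2,r3,r4,r5,r6,r7,r8,r9,r10,r11,r12,r13,r14,r15,r16,r17,r18,r19,r20,
      n]. x < 2 ^ b" "2 \<le> b" "lo + t < 2 ^ b"
  shows "run R (wide b) isqrt_prog
     (st [r0,r1,r2,r3,r4,r5,r6,r7,r8,r9,r10,r11,r12,r13,r14,r15,r16,r17,r18,r19,r20,n,lo,t,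
       0,0,0,1,2])
     (30 * len t + 1)
     (st [r0,r1,r2,r3,r4,r5,r6,r7,r8,r9,r10,r11,r12,r13,r14,r15,r16,r17,r18,r19,r20,n,
       bisect n lo t,0,0,0,0,1,2])"
  using assms(3)
proof (induction t arbitrary: lo rule: less_induct)
  case (less t)
  let ?st = "\<lambda>lo t. st [r0,r1,r2,r3,r4,r5,r6,r7,r8,r9,r10,r11,r12,r13,r14,r15,r16,r17,r18,r19,r20,
    n,lo,t,0,0,0,1,2]"
  have two: "2 < (2::nat) ^ b" using power_increasing[of 2 b "2::nat"] assms(2) by simp
  have b: "\<forall>x\<in>set [r0,r1,r2,r3,r4,r5,r6,r7,r8,r9,r10,r11,r12,r13,r14,r15,r16,r17,r18,r19,r20,
      n,lo,t,0,0,0,1,2]. x < 2 ^ b"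
    using assms(1) less.prems two by auto
  show ?case
  proof (cases "t = 0")
    case True
    then show ?thesis
      using run_While_False_st[OF b, of 23 R "blk isqrt_body"] by (simp add: isqrt_prog_def floorlog_def)
  next
    case False
    let ?lo = "lo + (if (lo + (t + 1) div 2)\<^sup>2 \<le> n then (t + 1) div 2 else 0)"
    have "(t + 1) div 2 + t div 2 \<le> t" by presburger
    then have "?lo + t div 2 \<le> lo + t" by (simp only: split: if_split) linarith
    with less.prems have "?lo + t div 2 < 2 ^ b" by linarith
    then have *: "run R (wide b) isqrt_prog (?st ?lo (t div 2)) (30 * len (t div 2) + 1)
        (?st (bisect n ?lo (t div 2)) 0)"
      using False less.IH[of "t div 2" ?lo] by simp
    have "run R (wide b) isqrt_prog (?st lo t) (1 + 29 + (30 * len (t div 2) + 1))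
        (?st (bisect n ?lo (t div 2)) 0)"
      unfolding isqrt_prog_def
      by (rule run_While_True_st[OF b _ _ run_isqrt_body[OF b assms(2)]])
        (use False * in \<open>simp_all add: isqrt_prog_def\<close>)
    moreover have "len t = len (t div 2) + 1"
      using False by (subst compute_floorlog) auto
    ultimately show ?thesis
      using False by (subst bisect.simps) simp
  qed
qed

section \<open>Selecting an admissible residue\<close>

text \<open>\<open>P - 1\<close> plays the part of -1, since machine subtraction truncates; this is
  the test for a square discriminant modulo \<open>P\<close>. For \<open>P = 1\<close> everything is
  admissible, which makes the levels at non-primes trivial.\<close>

definition admissible :: "nat \<Rightarrow> nat \<Rightarrow> nat \<Rightarrow> nat \<Rightarrow> bool" where
  "admissible N s P x \<longleftrightarrow> (\<exists>z<P. ((P - 1) * z * z + ((s + x)\<^sup>2 - 4 * N) mod P) mod P = 0)"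

lemma run_roots:
  assumes "\<forall>x\<in>set [r0,r1,r2,r3,r4,r5,r6,r7,r8,r9,r10,r11,P,r13,r14,r15,r16,r17,A]. x < 2 ^ b"
    "2 \<le> b"
  shows "run R (wide b) (While_Nonzero 18 (blk root_body))
     (st [r0,r1,r2,r3,r4,r5,r6,r7,r8,r9,r10,r11,P,r13,r14,r15,r16,r17,P,1,A,0,0,0,0,0,0,1,2])
     (P * 30 + 1)
     (st [r0,r1,r2,r3,r4,r5,r6,r7,r8,r9,r10,r11,P,r13,r14,r15,r16,r17,0,
       if \<exists>z<P. ((P - 1) * z * z + A) mod P = 0 then 0 else 1,A,0,0,0,0,0,0,1,2])"
proof -
  have two: "2 < (2::nat) ^ b" using power_increasing[of 2 b "2::nat"] assms(2) by simp
  define Q where "Q = (\<lambda>z. ((P - 1) * z * z + A) mod P = 0)"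
  \<comment> \<open>After \<open>i\<close> passes the roots from \<open>P - i\<close> up to
    \<open>P - 1\<close> have been tried.\<close>
  define E where "E = (\<lambda>i. \<exists>z<P. P - i \<le> z \<and> Q z)"
  let ?V = "\<lambda>i. if E i then 0 else 1 :: nat"
  define \<sigma> where "\<sigma> = (\<lambda>i. [r0,r1,r2,r3,r4,r5,r6,r7,r8,r9,r10,r11,P,r13,r14,r15,r16,r17,P - i,
    ?V i,A,0,0,0,0,0,0,1,2])"
  have main: "run R (wide b) (While_Nonzero 18 (blk root_body)) (st (\<sigma> 0)) (P * (29 + 1) + 1) (st (\<sigma> P))"
  proof (rule run_While_st)
    show less: "\<forall>x\<in>set (\<sigma> i). x < 2 ^ b" for i
      unfolding \<sigma>_def using assms(1) two less_imp_diff_less[of P "2 ^ b" i] by simp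
    fix i assume i: "i < P"
    have V: "?V (Suc i) = ?V i - (1 - ((P - 1) * (P - Suc i) * (P - Suc i) + A) mod P)"
    proof -
      have "P - Suc i \<le> z \<longleftrightarrow> z = P - Suc i \<or> P - i \<le> z" for z using i by auto
      then have *: "E (Suc i) \<longleftrightarrow> Q (P - Suc i) \<or> E i"
        unfolding E_def using i by (metis diff_less less_nat_zero_code not_gr_zero zero_less_Suc)
      have "1 - ((P - 1) * (P - Suc i) * (P - Suc i) + A) mod P = (if Q (P - Suc i) then 1 else 0)"
        by (simp add: Q_def)
      with * show ?thesis by simp
    qed
    have "fold lstep root_body (\<sigma> i) = \<sigma> (Suc i)"
      unfolding \<sigma>_def V by (simp only: root_body_def step_simps diff_diff_left One_nat_def add_0_right add_Suc_right)
    then show "run R (wide b) (blk root_body) (st (\<sigma> i)) 29 (st (\<sigma> (Suc i)))"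
      by (rule run_blk[OF straight_blocks(2) assms(2) _ _ less]) (simp add: \<sigma>_def)
  qed (simp_all add: \<sigma>_def E_def)
  have s0: "\<sigma> 0 = [r0,r1,r2,r3,r4,r5,r6,r7,r8,r9,r10,r11,P,r13,r14,r15,r16,r17,P,1,A,
      0,0,0,0,0,0,1,2]"
    by (auto simp: \<sigma>_def E_def)
  have sP: "\<sigma> P = [r0,r1,r2,r3,r4,r5,r6,r7,r8,r9,r10,r11,P,r13,r14,r15,r16,r17,0,
      if \<exists>z<P. ((P - 1) * z * z + A) mod P = 0 then 0 else 1,A,0,0,0,0,0,0,1,2]"
    by (simp add: \<sigma>_def E_def Q_def)
  show ?thesis by (rule run_mono[OF main[unfolded s0 sP]]) simp
qed

lemma run_sel_body:
  assumes "\<forall>x\<in>set [N,r1,r2,r3,s,r5,r6,r7,r8,M,r10,T,P,i,Suc j,cnt,T',j * M + T]. x < 2 ^ b"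
    "2 \<le> b" "0 < P"
  shows "run R (wide b) sel_body
     (st [N,r1,r2,r3,s,r5,r6,r7,r8,M,r10,T,P,i,Suc j,cnt,T',0,0,0,0,0,0,0,0,0,0,1,2])
     (P * 30 + 59)
     (st [N,r1,r2,r3,s,r5,r6,r7,r8,M,r10,T,P,i,j,
       cnt + (if admissible N s P (j * M + T) then 1 else 0),
       T' + (if admissible N s P (j * M + T) \<and> cnt = i then j * M + T else 0),
       0,0,0,0,0,0,0,0,0,0,1,2])"
proof -
  let ?x = "j * M + T"
  let ?A = "((s + ?x)\<^sup>2 - 4 * N) mod P"
  let ?V = "if \<exists>z<P. ((P - 1) * z * z + ?A) mod P = 0 then 0 else 1 :: nat"
  have two: "2 < (2::nat) ^ b" using power_increasing[of 2 b "2::nat"] assms(2) by simp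
  have A: "?A < 2 ^ b"
    using assms(1) mod_less_divisor[OF assms(3), of "(s + ?x)\<^sup>2 - 4 * N"] by (auto simp del: mod_less_divisor)
  have less1: "\<forall>x\<in>set [N,r1,r2,r3,s,r5,r6,r7,r8,M,r10,T,P,i,Suc j,cnt,T',0,0,0,0,0,0,0,0,0,0,1,2].
      x < 2 ^ b"
    using assms(1) two by simp
  have 1: "run R (wide b) (blk sel_init)
     (st [N,r1,r2,r3,s,r5,r6,r7,r8,M,r10,T,P,i,Suc j,cnt,T',0,0,0,0,0,0,0,0,0,0,1,2])
     29 (st [N,r1,r2,r3,s,r5,r6,r7,r8,M,r10,T,P,i,j,cnt,T',?x,P,1,?A,0,0,0,0,0,0,1,2])"
    by (rule run_blk[OF straight_blocks(3) assms(2) _ _ less1])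
      (simp_all only: sel_init_def step_simps, simp_all add: power2_eq_square)
  have 2: "run R (wide b) (While_Nonzero 18 (blk root_body))
     (st [N,r1,r2,r3,s,r5,r6,r7,r8,M,r10,T,P,i,j,cnt,T',?x,P,1,?A,0,0,0,0,0,0,1,2])
     (P * 30 + 1)
     (st [N,r1,r2,r3,s,r5,r6,r7,r8,M,r10,T,P,i,j,cnt,T',?x,0,?V,?A,0,0,0,0,0,0,1,2])"
    by (rule run_roots[OF _ assms(2)]) (use assms(1) A in simp)
  define v where "v = ?V"
  have v: "v < 2 ^ b" using two by (simp add: v_def)
  have cnt: "cnt + (1 - v) = cnt + (if admissible N s P ?x then 1 else 0)"
    by (simp add: v_def admissible_def)
  have T': "T' + (1 - (cnt - i + (i - cnt))) * (1 - v) * ?x =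
      T' + (if admissible N s P ?x \<and> cnt = i then ?x else 0)"
  proof -
    have "1 - (cnt - i + (i - cnt)) = (if cnt = i then 1 else 0)" by auto
    moreover have "1 - v = (if admissible N s P ?x then 1 else 0)"
      by (simp add: v_def admissible_def)
    ultimately show ?thesis by (simp only:) simp
  qed
  have less3: "\<forall>x\<in>set [N,r1,r2,r3,s,r5,r6,r7,r8,M,r10,T,P,i,j,cnt,T',?x,0,v,?A,0,0,0,0,0,0,1,2].
      x < 2 ^ b"
    using assms(1) two A v by simp
  have 3: "run R (wide b) (blk sel_final)
     (st [N,r1,r2,r3,s,r5,r6,r7,r8,M,r10,T,P,i,j,cnt,T',?x,0,v,?A,0,0,0,0,0,0,1,2])
     29 (st [N,r1,r2,r3,s,r5,r6,r7,r8,M,r10,T,P,i,j,cnt + (1 - v),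
       T' + (1 - (cnt - i + (i - cnt))) * (1 - v) * ?x,0,0,0,0,0,0,0,0,0,0,1,2])"
    by (rule run_blk[OF straight_blocks(4) assms(2) _ _ less3])
      (simp_all only: sel_final_def step_simps, simp)
  have "run R (wide b) sel_body
     (st [N,r1,r2,r3,s,r5,r6,r7,r8,M,r10,T,P,i,Suc j,cnt,T',0,0,0,0,0,0,0,0,0,0,1,2])
     (29 + (P * 30 + 1 + 29))
     (st [N,r1,r2,r3,s,r5,r6,r7,r8,M,r10,T,P,i,j,cnt + (1 - v),
       T' + (1 - (cnt - i + (i - cnt))) * (1 - v) * ?x,0,0,0,0,0,0,0,0,0,0,1,2])"
    unfolding sel_body_def by (rule run_Seq[OF 1 run_Seq[OF 2[folded v_def] 3]])
  then show ?thesis unfolding cnt T' by (rule run_mono) simp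
qed

text \<open>
  The residues above a given admissible one determine its digit: \<open>select\<close> has at most one nonzero
  summand, and every admissible residue below \<open>P M\<close> in the class of \<open>T\<close> is selected by some digit.
\<close>

definition rank :: "nat \<Rightarrow> nat \<Rightarrow> nat \<Rightarrow> nat \<Rightarrow> nat \<Rightarrow> nat \<Rightarrow> nat" where
  "rank N s P M T k = card {l\<in>{k..<P}. admissible N s P (l * M + T)}"

definition select :: "nat \<Rightarrow> nat \<Rightarrow> nat \<Rightarrow> nat \<Rightarrow> nat \<Rightarrow> nat \<Rightarrow> nat \<Rightarrow> nat" where
  "select N s P M T i j = (\<Sum>k\<in>{j..<P}.
     if admissible N s P (k * M + T) \<and> rank N s P M T (Suc k) = i then k * M + T else 0)"

lemma atLeastLessThan_split: "j < (P::nat) \<Longrightarrow> {j..<P} = insert j {Suc j..<P}"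
  by auto

lemma rank_step:
  assumes "j < P"
  shows "rank N s P M T j =
    rank N s P M T (Suc j) + (if admissible N s P (j * M + T) then 1 else 0)"
proof -
  have "{l\<in>{j..<P}. admissible N s P (l * M + T)} =
    (if admissible N s P (j * M + T) then insert j else id)
      {l\<in>{Suc j..<P}. admissible N s P (l * M + T)}"
    using assms by (auto simp: atLeastLessThan_split)
  then show ?thesis by (auto simp: rank_def)
qed

lemma select_step:
  "j < P \<Longrightarrow> select N s P M T i j = select N s P M T i (Suc j) +
    (if admissible N s P (j * M + T) \<and> rank N s P M T (Suc j) = i then j * M + T else 0)"
  by (simp add: select_def atLeastLessThan_split)

lemma rank_antimono: "j \<le> k \<Longrightarrow> rank N s P M T k \<le> rank N s P M T j"
  unfolding rank_def by (rule card_mono) auto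

lemma rank_le: "rank N s P M T k \<le> P"
proof -
  have "rank N s P M T k \<le> card {0..<P}" unfolding rank_def by (rule card_mono) auto
  then show ?thesis by simp
qed

text \<open>The rank just above the smaller of two admissible digits also counts the larger one, so
  distinct digits have distinct ranks.\<close>

lemma rank_unique:
  assumes "admissible N s P (k * M + T)" "k < P" "admissible N s P (l * M + T)" "l < P"
    "rank N s P M T (Suc k) = rank N s P M T (Suc l)"
  shows "k = l"
proof -
  have "\<not> k < l" if "admissible N s P (l * M + T)" "l < P"
    "rank N s P M T (Suc k) = rank N s P M T (Suc l)" for k l
    using rank_antimono[of "Suc k" l N s P M T] rank_step[of l P N s M T] that by auto
  from this[of l k] this[of k l] assms show ?thesis by fastforce
qed

lemma select_eq:
  assumes "admissible N s P (k * M + T)" "k < P" "j \<le> k"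
  shows "select N s P M T (rank N s P M T (Suc k)) j = k * M + T"
proof -
  have "select N s P M T (rank N s P M T (Suc k)) j = (\<Sum>l\<in>{j..<P}. if l = k then k * M + T else 0)"
    unfolding select_def by (rule sum.cong) (use assms rank_unique in auto)
  also have "\<dots> = k * M + T" using assms by simp
  finally show ?thesis .
qed

lemma select_less:
  assumes "T < M" "0 < P"
  shows "select N s P M T i j < M * P"
proof (cases "\<exists>k. k < P \<and> j \<le> k \<and> admissible N s P (k * M + T) \<and> rank N s P M T (Suc k) = i")
  case True
  then obtain k where k: "k < P" "j \<le> k" "admissible N s P (k * M + T)" "rank N s P M T (Suc k) = i"
    by blast
  then have "select N s P M T i j = k * M + T" using select_eq[of N s P k M T j] by simp
  also have "\<dots> < Suc k * M" using assms by simp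
  also have "\<dots> \<le> M * P" using k by (metis Suc_leI mult.commute mult_le_mono2)
  finally show ?thesis .
next
  case False
  then have "select N s P M T i j = 0"
    unfolding select_def by (intro sum.neutral) auto
  with assms show ?thesis by auto
qed

lemma run_sel_loop:
  assumes "\<forall>x\<in>set [N,r1,r2,r3,s,r5,r6,r7,r8,M,r10,T,P,i,M * P]. x < 2 ^ b"
    "2 \<le> b" "0 < P" "T < M"
  shows "run R (wide b) (While_Nonzero 14 sel_body)
     (st [N,r1,r2,r3,s,r5,r6,r7,r8,M,r10,T,P,i,P,0,0,0,0,0,0,0,0,0,0,0,0,1,2])
     (P * (P * 30 + 60) + 1)
     (st [N,r1,r2,r3,s,r5,r6,r7,r8,M,r10,T,P,i,0,rank N s P M T 0,select N s P M T i 0,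
       0,0,0,0,0,0,0,0,0,0,1,2])"
proof -
  have two: "2 < (2::nat) ^ b" using power_increasing[of 2 b "2::nat"] assms(2) by simp
  have P: "P < 2 ^ b" and MP: "M * P < 2 ^ b" using assms(1) by auto
  \<comment> \<open>The loop register counts down, which is why \<open>rank\<close> and
    \<open>select\<close> are parametrised by the lower end of the range already processed.\<close>
  define \<sigma> where "\<sigma> = (\<lambda>k. [N,r1,r2,r3,s,r5,r6,r7,r8,M,r10,T,P,i,P - k,rank N s P M T (P - k),
       select N s P M T i (P - k),0,0,0,0,0,0,0,0,0,0,1,2])"
  have rank: "rank N s P M T j < 2 ^ b" for j
    by (rule le_less_trans[OF rank_le P])
  have sel: "select N s P M T i j < 2 ^ b" for j
    by (rule less_trans[OF select_less[OF assms(4,3)] MP])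
  have main: "run R (wide b) (While_Nonzero 14 sel_body) (st (\<sigma> 0)) (P * (P * 30 + 59 + 1) + 1) (st (\<sigma> P))"
  proof (rule run_While_st)
    show less: "\<forall>x\<in>set (\<sigma> k). x < 2 ^ b" for k
      unfolding \<sigma>_def using assms(1) two less_imp_diff_less[of P "2 ^ b" k] rank sel by simp
    fix k assume k: "k < P"
    define j where "j = P - Suc k"
    have j: "P - k = Suc j" "P - Suc k = j" "j < P" using k by (auto simp: j_def)
    have "j * M + T < Suc j * M" using assms(4) by simp
    also have "\<dots> \<le> P * M" using j by (intro mult_le_mono1) simp
    finally have "j * M + T < 2 ^ b" using MP by (simp add: mult.commute)
    then show "run R (wide b) sel_body (st (\<sigma> k)) (P * 30 + 59) (st (\<sigma> (Suc k)))"
      unfolding \<sigma>_def j rank_step[OF j(3)] select_step[OF j(3)]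
      by (intro run_sel_body[OF _ assms(2,3)]) (use assms(1) rank sel less[of k] j in \<open>simp add: \<sigma>_def\<close>)
  qed (auto simp: \<sigma>_def)
  have s0: "\<sigma> 0 = [N,r1,r2,r3,s,r5,r6,r7,r8,M,r10,T,P,i,P,0,0,0,0,0,0,0,0,0,0,0,0,1,2]"
    by (simp add: \<sigma>_def rank_def select_def)
  have sP: "\<sigma> P = [N,r1,r2,r3,s,r5,r6,r7,r8,M,r10,T,P,i,0,rank N s P M T 0,select N s P M T i 0,
       0,0,0,0,0,0,0,0,0,0,1,2]"
    by (simp add: \<sigma>_def)
  show ?thesis by (rule run_mono[OF main[unfolded s0 sP]]) simp
qed

section \<open>Decoding the counter\<close>

lemma run_level_body:
  fixes F p q :: nat
  defines "P \<equiv> if p dvd F then 1 else p"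
  defines "d \<equiv> P div 2 + 1"
  assumes "\<forall>x\<in>set [N,r1,r2,r3,s,r5,Suc w,p,F,M,q,T,M * P]. x < 2 ^ b" "2 \<le> b" "0 < p" "T < M"
  shows "run R (wide b) level_body
     (st [N,r1,r2,r3,s,r5,Suc w,p,F,M,q,T,0,0,0,0,0,0,0,0,0,0,0,0,0,0,0,1,2])
     (P * (P * 30 + 60) + 59)
     (st [N,r1,r2,r3,s,r5,w,p + 1,F * p * p,M * P,q div d,select N s P M T (q mod d) 0,
       0,0,0,0,0,0,0,0,0,0,0,0,0,0,0,1,2])"
proof -
  have two: "2 < (2::nat) ^ b" using power_increasing[of 2 b "2::nat"] assms(4) by simp
  have P: "0 < P" "P \<le> p" using assms(5) by (auto simp: P_def)
  have P_eq: "(1 - (1 - F mod p)) * (p - 1) + 1 = P"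
    using assms(5) by (auto simp: P_def dvd_eq_mod_eq_0)
  have Pb: "P < 2 ^ b" using P assms(3) by simp
  have qd: "q div d < 2 ^ b" "q mod d < 2 ^ b"
    using assms(3) by (auto intro: le_less_trans[OF div_le_dividend] le_less_trans[OF mod_less_eq_dividend])
  have rank: "rank N s P M T 0 < 2 ^ b"
    by (rule le_less_trans[OF rank_le Pb])
  have sel: "select N s P M T i 0 < 2 ^ b" for i
    by (rule less_trans[OF select_less[OF assms(6) P(1)]]) (use assms(3) in simp)
  have less1: "\<forall>x\<in>set [N,r1,r2,r3,s,r5,Suc w,p,F,M,q,T,0,0,0,0,0,0,0,0,0,0,0,0,0,0,0,1,2].
      x < 2 ^ b"
    using assms(3) two by simp
  have "run R (wide b) (blk level_init)
     (st [N,r1,r2,r3,s,r5,Suc w,p,F,M,q,T,0,0,0,0,0,0,0,0,0,0,0,0,0,0,0,1,2])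
     29 (st [N,r1,r2,r3,s,r5,Suc w,p,F,M,
       q div (((1 - (1 - F mod p)) * (p - 1) + 1) div 2 + 1),T,(1 - (1 - F mod p)) * (p - 1) + 1,
       q mod (((1 - (1 - F mod p)) * (p - 1) + 1) div 2 + 1),(1 - (1 - F mod p)) * (p - 1) + 1,
       0,0,0,0,0,0,0,0,0,0,0,0,1,2])"
    by (rule run_blk[OF straight_blocks(5) assms(4) _ _ less1])
      (simp_all only: level_init_def step_simps, simp)
  then have 1: "run R (wide b) (blk level_init)
     (st [N,r1,r2,r3,s,r5,Suc w,p,F,M,q,T,0,0,0,0,0,0,0,0,0,0,0,0,0,0,0,1,2])
     29 (st [N,r1,r2,r3,s,r5,Suc w,p,F,M,q div d,T,P,q mod d,P,0,0,0,0,0,0,0,0,0,0,0,0,1,2])"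
    unfolding P_eq d_def[symmetric] .
  have 2: "run R (wide b) (While_Nonzero 14 sel_body)
     (st [N,r1,r2,r3,s,r5,Suc w,p,F,M,q div d,T,P,q mod d,P,0,0,0,0,0,0,0,0,0,0,0,0,1,2])
     (P * (P * 30 + 60) + 1)
     (st [N,r1,r2,r3,s,r5,Suc w,p,F,M,q div d,T,P,q mod d,0,rank N s P M T 0,
       select N s P M T (q mod d) 0,0,0,0,0,0,0,0,0,0,0,1,2])"
    by (rule run_sel_loop[OF _ assms(4) P(1) assms(6)]) (use assms(3) Pb qd in simp)
  have less3: "\<forall>x\<in>set [N,r1,r2,r3,s,r5,Suc w,p,F,M,q div d,T,P,q mod d,0,rank N s P M T 0,
       select N s P M T (q mod d) 0,0,0,0,0,0,0,0,0,0,0,1,2]. x < 2 ^ b"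
    using assms(3) Pb qd two rank sel by simp
  have 3: "run R (wide b) (blk level_final)
     (st [N,r1,r2,r3,s,r5,Suc w,p,F,M,q div d,T,P,q mod d,0,rank N s P M T 0,
       select N s P M T (q mod d) 0,0,0,0,0,0,0,0,0,0,0,1,2])
     29 (st [N,r1,r2,r3,s,r5,w,p + 1,F * p * p,M * P,q div d,select N s P M T (q mod d) 0,
       0,0,0,0,0,0,0,0,0,0,0,0,0,0,0,1,2])"
    by (rule run_blk[OF straight_blocks(6) assms(4) _ _ less3])
      (simp_all only: level_final_def step_simps, simp_all)
  show ?thesis
    unfolding level_body_def by (rule run_mono[OF run_Seq[OF 1 run_Seq[OF 2 3]]]) simp
qed

section \<open>Primorials and mixed-radix codes of residues\<close>

definition prime_or_one :: "nat \<Rightarrow> nat" where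
  "prime_or_one x = (if prime x then x else 1)"

definition primorial :: "nat \<Rightarrow> nat" where
  "primorial x = (\<Prod>p\<in>{1..x}. prime_or_one p)"

text \<open>For a prime \<open>p\<close> not dividing \<open>N\<close>, the digit base bounds the
  number of admissible residues modulo \<open>p\<close>. At 2 the base is 2 and nothing is saved; at
  non-primes it is 1, so these levels consume no part of the counter.\<close>

definition codes :: "nat \<Rightarrow> nat" where
  "codes x = (\<Prod>p\<in>{1..x}. prime_or_one p div 2 + 1)"

text \<open>Incremental Chinese remaindering: adding a multiple of \<open>primorial x\<close> keeps
  all earlier residues, and the digit is the rank of the chosen multiple among the admissible ones.
  A digit that matches no rank yields 0.\<close>

primrec decode :: "nat \<Rightarrow> nat \<Rightarrow> nat \<Rightarrow> nat \<Rightarrow> nat" where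
  "decode N s c 0 = 0"
| "decode N s c (Suc x) = select N s (prime_or_one (Suc x)) (primorial x) (decode N s c x)
     ((c div codes x) mod (prime_or_one (Suc x) div 2 + 1)) 0"

lemma prime_or_one_pos: "0 < prime_or_one x"
  by (auto simp: prime_or_one_def intro: prime_gt_0_nat)

lemma primorial_0 [simp]: "primorial 0 = 1" by (simp add: primorial_def)
lemma codes_0 [simp]: "codes 0 = 1" by (simp add: codes_def)

lemma primorial_Suc: "primorial (Suc x) = primorial x * prime_or_one (Suc x)"
  by (simp add: primorial_def prod.nat_ivl_Suc')

lemma codes_Suc: "codes (Suc x) = codes x * (prime_or_one (Suc x) div 2 + 1)"
  by (simp add: codes_def prod.nat_ivl_Suc')

lemma primorial_pos: "0 < primorial x"
  by (induction x) (simp_all add: primorial_Suc prime_or_one_pos)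

lemma codes_pos: "0 < codes x"
  by (induction x) (simp_all add: codes_Suc)

lemma prime_or_one_le: "0 < x \<Longrightarrow> prime_or_one x \<le> x"
  by (simp add: prime_or_one_def)

lemma primorial_le_fact: "primorial x \<le> fact x"
proof (induction x)
  case (Suc x)
  then have "primorial x * prime_or_one (Suc x) \<le> fact x * Suc x"
    by (intro mult_le_mono prime_or_one_le) auto
  then show ?case by (simp add: primorial_Suc mult.commute)
qed simp

lemma codes_le_primorial: "codes x \<le> primorial x"
proof (induction x)
  case (Suc x)
  have "prime_or_one (Suc x) div 2 + 1 \<le> prime_or_one (Suc x)"
    using prime_ge_2_nat[of "Suc x"] by (auto simp: prime_or_one_def)
  with Suc show ?case unfolding primorial_Suc codes_Suc by (rule mult_le_mono)
qed simp

lemma codes_mono: "x \<le> y \<Longrightarrow> codes x \<le> codes y"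
  by (rule lift_Suc_mono_le[of codes]) (simp_all add: codes_Suc)

lemma decode_less: "decode N s c x < primorial x"
  by (induction x) (simp_all add: primorial_Suc prime_or_one_pos select_less)

text \<open>A variant of Wilson's theorem; squaring the factorial takes care of the number 4.\<close>

lemma Suc_dvd_fact_square_iff: "Suc x dvd (fact x)\<^sup>2 \<longleftrightarrow> \<not> prime (Suc x)"
proof
  assume *: "Suc x dvd (fact x)\<^sup>2"
  show "\<not> prime (Suc x)"
  proof
    assume "prime (Suc x)"
    with * show False by (auto simp: prime_dvd_power_iff prime_dvd_fact_iff)
  qed
next
  assume np: "\<not> prime (Suc x)"
  show "Suc x dvd (fact x)\<^sup>2"
  proof (cases "x = 0")
    case False
    with np obtain a where a: "a dvd Suc x" "a \<noteq> 1" "a \<noteq> Suc x"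
      by (auto simp: prime_nat_iff)
    then obtain c where c: "Suc x = a * c" by blast
    with a False have "1 \<le> a" "a \<le> x" "1 \<le> c" "c \<le> x"
      by (auto intro: Nat.gr0I simp: dvd_imp_le less_Suc_eq_le[symmetric] nat_dvd_not_less intro!: le_neq_implies_less)
    then have "a dvd fact x" "c dvd fact x" by (auto intro: dvd_fact)
    then show ?thesis unfolding c power2_eq_square by (rule mult_dvd_mono)
  qed simp
qed

lemma run_decode:
  assumes "\<forall>x\<in>set [N,r1,X,c,s,r5,X + 1,(fact X)\<^sup>2]. x < 2 ^ b" "2 \<le> b"
  shows "run R (wide b) (While_Nonzero 6 level_body)
     (st [N,r1,X,c,s,r5,X,1,1,1,c,0,0,0,0,0,0,0,0,0,0,0,0,0,0,0,0,1,2])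
     (X * (X * (X * 30 + 60) + 60) + 1)
     (st [N,r1,X,c,s,r5,0,X + 1,(fact X)\<^sup>2,primorial X,c div codes X,decode N s c X,
       0,0,0,0,0,0,0,0,0,0,0,0,0,0,0,1,2])"
proof -
  have two: "2 < (2::nat) ^ b" using power_increasing[of 2 b "2::nat"] assms(2) by simp
  have F: "(fact x)\<^sup>2 < (2::nat) ^ b" if "x \<le> X" for x
  proof -
    have "(fact x)\<^sup>2 \<le> (fact X :: nat)\<^sup>2" by (intro power_mono fact_mono_nat that) auto
    also have "\<dots> < 2 ^ b" using assms(1) by simp
    finally show ?thesis .
  qed
  have M: "primorial x < 2 ^ b" if "x \<le> X" for x
  proof -
    have "(fact x :: nat) \<le> (fact x)\<^sup>2" by (simp add: power2_eq_square)
    with primorial_le_fact[of x] F[OF that] show ?thesis by linarith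
  qed
  define \<sigma> where "\<sigma> = (\<lambda>x. [N,r1,X,c,s,r5,X - x,x + 1,(fact x)\<^sup>2,primorial x,c div codes x,decode N s c x,
       0,0,0,0,0,0,0,0,0,0,0,0,0,0,0,1,2])"
  have main: "run R (wide b) (While_Nonzero 6 level_body) (st (\<sigma> 0))
      (X * ((X * (X * 30 + 60) + 59) + 1) + 1) (st (\<sigma> X))"
  proof (rule run_While_st)
    show less: "\<forall>y\<in>set (\<sigma> x). y < 2 ^ b" if "x \<le> X" for x
    proof -
      have "c div codes x < 2 ^ b" using assms(1) by (auto intro: le_less_trans[OF div_le_dividend])
      moreover have "decode N s c x < 2 ^ b" using M[OF that] decode_less[of N s c x] by linarith
      ultimately show ?thesis
        unfolding \<sigma>_def using assms(1) two less_imp_diff_less[of X "2 ^ b" x] F[OF that] M[OF that] that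
        by simp
    qed
    fix x assume x: "x < X"
    define P where "P = (if x + 1 dvd (fact x)\<^sup>2 then 1 else x + 1)"
    have P: "P = prime_or_one (Suc x)" using Suc_dvd_fact_square_iff[of x] by (auto simp: P_def prime_or_one_def)
    have fact: "(fact x)\<^sup>2 * (x + 1) * (x + 1) = (fact (Suc x))\<^sup>2"
      by (simp add: power2_eq_square algebra_simps)
    have w: "X - x = Suc (X - Suc x)" using x by simp
    have next_state: "\<sigma> (Suc x) = [N,r1,X,c,s,r5,X - Suc x,x + 1 + 1,(fact x)\<^sup>2 * (x + 1) * (x + 1),
      primorial x * P,c div codes x div (P div 2 + 1),
      select N s P (primorial x) (decode N s c x) (c div codes x mod (P div 2 + 1)) 0,
      0,0,0,0,0,0,0,0,0,0,0,0,0,0,0,1,2]"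
      unfolding \<sigma>_def fact P primorial_Suc codes_Suc div_mult2_eq decode.simps by simp
    have "run R (wide b) level_body (st (\<sigma> x)) (P * (P * 30 + 60) + 59) (st (\<sigma> (Suc x)))"
      unfolding next_state unfolding \<sigma>_def w
      by (rule run_level_body[where p = "x + 1" and F = "(fact x)\<^sup>2", folded P_def, OF _ assms(2)])
        (use less[of x] M[of "Suc x"] x decode_less in \<open>simp_all add: \<sigma>_def w P primorial_Suc\<close>)
    moreover have "P \<le> X" using x prime_or_one_le[of "Suc x"] by (simp add: P)
    then have "P * (P * 30 + 60) + 59 \<le> X * (X * 30 + 60) + 59"
      by (intro add_le_mono mult_le_mono) auto
    ultimately show "run R (wide b) level_body (st (\<sigma> x)) (X * (X * 30 + 60) + 59) (st (\<sigma> (Suc x)))"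
      by (rule run_mono)
  qed (simp_all add: \<sigma>_def)
  have s0: "\<sigma> 0 = [N,r1,X,c,s,r5,X,1,1,1,c,0,0,0,0,0,0,0,0,0,0,0,0,0,0,0,0,1,2]"
    by (simp add: \<sigma>_def)
  have sX: "\<sigma> X = [N,r1,X,c,s,r5,0,X + 1,(fact X)\<^sup>2,primorial X,c div codes X,decode N s c X,
       0,0,0,0,0,0,0,0,0,0,0,0,0,0,0,1,2]"
    by (simp add: \<sigma>_def)
  show ?thesis by (rule run_mono[OF main[unfolded s0 sX]]) (simp add: add.assoc)
qed

section \<open>The search loop\<close>

text \<open>Apart from trial division by \<open>X\<close>, this is the smaller root of
  \<open>y^2 - S y + N\<close> with \<open>S = s + decode N s c X\<close>, rounded if the
  discriminant is not a square; \<open>defect\<close> judges the outcome.\<close>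

definition candidate :: "nat \<Rightarrow> nat \<Rightarrow> nat \<Rightarrow> nat \<Rightarrow> nat" where
  "candidate N s X c = (if X dvd N then X else
     (s + decode N s c X - isqrt ((s + decode N s c X)\<^sup>2 - 4 * N)) div 2)"

text \<open>A sum of naturals vanishes only if each summand does, so three conditions become one
  loop flag: divisibility, \<open>2 <= u\<close> and \<open>u < N\<close>.\<close>

definition defect :: "nat \<Rightarrow> nat \<Rightarrow> nat" where
  "defect N u = N mod u + (2 - u) + (u + 1 - N)"

lemma defect_eq_0_iff: "defect N u = 0 \<longleftrightarrow> proper_factor u N"
  by (auto simp: defect_def proper_factor_def dvd_eq_mod_eq_0)

lemma candidate_le: "candidate N s X c \<le> X + s + primorial X"
proof -
  have "(a - r) div 2 \<le> a" for a r :: nat by (rule order_trans[OF div_le_dividend]) simp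
  then have "(s + decode N s c X - isqrt ((s + decode N s c X)\<^sup>2 - 4 * N)) div 2 \<le> s + decode N s c X" .
  with decode_less[of N s c X] show ?thesis unfolding candidate_def by auto
qed

lemma defect_le: "defect N u \<le> N + u + 3"
proof -
  have "N mod u \<le> N" by simp
  then show ?thesis unfolding defect_def by linarith
qed

text \<open>The cubic term counts \<open>X\<close> levels with at most \<open>X\<close> digits and
  \<open>X\<close> trial roots each, \<open>30 * b\<close> pays for the square root, and 89 for
  three blocks of 29 and the failing tests of two loops.\<close>

definition body_cost :: "nat \<Rightarrow> nat \<Rightarrow> nat" where
  "body_cost b X = X * (X * (X * 30 + 60) + 60) + 30 * b + 89"

lemma run_cand_body:
  assumes "\<forall>x\<in>set [N,g,X,c,s,u,X + 1,(fact X)\<^sup>2,(s + primorial X)\<^sup>2]. x < 2 ^ b" "2 \<le> b"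
  shows "run R (wide b) cand_body
     (st [N,g,X,c,s,u,0,0,0,0,0,0,0,0,0,0,0,0,0,0,0,0,0,0,0,0,0,1,2])
     (body_cost b X)
     (st [N,defect N (candidate N s X c),
       if c < codes X then X else X + 1,if c < codes X then c + 1 else 0,
       s,candidate N s X c,0,0,0,0,0,0,0,0,0,0,0,0,0,0,0,0,0,0,0,0,0,1,2])"
proof -
  have two: "2 < (2::nat) ^ b" using power_increasing[of 2 b "2::nat"] assms(2) by simp
  let ?T = "decode N s c X"
  let ?q = "c div codes X"
  let ?n = "(s + ?T)\<^sup>2 - 4 * N"
  have "primorial X \<le> s + primorial X" by simp
  also have "\<dots> \<le> (s + primorial X)\<^sup>2" by (simp add: power2_eq_square)
  also have "\<dots> < 2 ^ b" using assms(1) by simp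
  finally have M: "primorial X < 2 ^ b" .
  then have T: "?T < 2 ^ b" using decode_less[of N s c X] by linarith
  have "?n \<le> (s + ?T)\<^sup>2" by simp
  also have "\<dots> \<le> (s + primorial X)\<^sup>2" using decode_less[of N s c X] by (intro power_mono) auto
  also have "\<dots> < 2 ^ b" using assms(1) by simp
  finally have n: "?n < 2 ^ b" .
  have "isqrt ?n \<le> (isqrt ?n)\<^sup>2" by (simp add: power2_eq_square)
  with isqrt_bounds(1)[of ?n] n have lo: "isqrt ?n < 2 ^ b" by linarith
  have q: "?q < 2 ^ b" using assms(1) by (auto intro: le_less_trans[OF div_le_dividend])
  have less1: "\<forall>x\<in>set [N,g,X,c,s,u,0,0,0,0,0,0,0,0,0,0,0,0,0,0,0,0,0,0,0,0,0,1,2]. x < 2 ^ b"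
    using assms(1) two by simp
  have 1: "run R (wide b) (blk cand_init)
     (st [N,g,X,c,s,u,0,0,0,0,0,0,0,0,0,0,0,0,0,0,0,0,0,0,0,0,0,1,2])
     29 (st [N,g,X,c,s,u,X,1,1,1,c,0,0,0,0,0,0,0,0,0,0,0,0,0,0,0,0,1,2])"
    by (rule run_blk[OF straight_blocks(7) assms(2) _ _ less1])
      (simp_all only: cand_init_def step_simps, simp)
  have 2: "run R (wide b) (While_Nonzero 6 level_body)
     (st [N,g,X,c,s,u,X,1,1,1,c,0,0,0,0,0,0,0,0,0,0,0,0,0,0,0,0,1,2])
     (X * (X * (X * 30 + 60) + 60) + 1)
     (st [N,g,X,c,s,u,0,X + 1,(fact X)\<^sup>2,primorial X,?q,?T,
       0,0,0,0,0,0,0,0,0,0,0,0,0,0,0,1,2])"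
    by (rule run_decode[OF _ assms(2)]) (use assms(1) in simp)
  have less3: "\<forall>x\<in>set [N,g,X,c,s,u,0,X + 1,(fact X)\<^sup>2,primorial X,?q,?T,
       0,0,0,0,0,0,0,0,0,0,0,0,0,0,0,1,2]. x < 2 ^ b"
    using assms(1) two M T q by simp
  have n_eq: "(s + ?T) * (s + ?T) - (2 + 2) * N = ?n" by (simp add: power2_eq_square)
  have "run R (wide b) (blk cand_test)
     (st [N,g,X,c,s,u,0,X + 1,(fact X)\<^sup>2,primorial X,?q,?T,0,0,0,0,0,0,0,0,0,0,0,0,0,0,0,1,2])
     29 (st [N,g,X,c,s,u,0,X + 1,(fact X)\<^sup>2,primorial X,?q,?T,0,0,0,0,0,0,0,0,0,
       (s + ?T) * (s + ?T) - (2 + 2) * N,0,(s + ?T) * (s + ?T) - (2 + 2) * N,0,0,0,1,2])"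
    by (rule run_blk[OF straight_blocks(8) assms(2) _ _ less3])
      (simp_all only: cand_test_def step_simps, simp)
  then have 3: "run R (wide b) (blk cand_test)
     (st [N,g,X,c,s,u,0,X + 1,(fact X)\<^sup>2,primorial X,?q,?T,0,0,0,0,0,0,0,0,0,0,0,0,0,0,0,1,2])
     29 (st [N,g,X,c,s,u,0,X + 1,(fact X)\<^sup>2,primorial X,?q,?T,0,0,0,0,0,0,0,0,0,?n,0,?n,0,0,0,1,2])"
    unfolding n_eq .
  have "run R (wide b) isqrt_prog
     (st [N,g,X,c,s,u,0,X + 1,(fact X)\<^sup>2,primorial X,?q,?T,0,0,0,0,0,0,0,0,0,?n,0,?n,0,0,0,1,2])
     (30 * len ?n + 1)
     (st [N,g,X,c,s,u,0,X + 1,(fact X)\<^sup>2,primorial X,?q,?T,0,0,0,0,0,0,0,0,0,?n,isqrt ?n,0,0,0,0,1,2])"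
    unfolding isqrt_def
    by (rule run_isqrt_aux[OF _ assms(2)]) (use assms(1) two M T q n in simp_all)
  moreover have "30 * len ?n + 1 \<le> 30 * b + 1" using n by (simp add: len_le_iff)
  ultimately have 4: "run R (wide b) isqrt_prog
     (st [N,g,X,c,s,u,0,X + 1,(fact X)\<^sup>2,primorial X,?q,?T,0,0,0,0,0,0,0,0,0,?n,0,?n,0,0,0,1,2])
     (30 * b + 1)
     (st [N,g,X,c,s,u,0,X + 1,(fact X)\<^sup>2,primorial X,?q,?T,0,0,0,0,0,0,0,0,0,?n,isqrt ?n,0,0,0,0,1,2])"
    by (rule run_mono)
  define v where "v = (s + ?T - isqrt ?n) div 2 * (1 - (1 - N mod X)) + (1 - N mod X) * X"
  have v: "v = candidate N s X c"
    unfolding v_def candidate_def by (simp add: dvd_eq_mod_eq_0)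
  have less5: "\<forall>x\<in>set [N,g,X,c,s,u,0,X + 1,(fact X)\<^sup>2,primorial X,?q,?T,0,0,0,0,0,0,0,0,0,?n,isqrt ?n,
       0,0,0,0,1,2]. x < 2 ^ b"
    using assms(1) two M T q n lo by simp
  have "?q = 0 \<longleftrightarrow> c < codes X" using codes_pos[of X] by (simp add: div_eq_0_iff)
  then have X': "X + (1 - (1 - ?q)) = (if c < codes X then X else X + 1)"
    and c': "(c + 1) * (1 - ?q) = (if c < codes X then c + 1 else 0)"
    by (cases ?q; simp)+
  have "run R (wide b) (blk cand_final)
     (st [N,g,X,c,s,u,0,X + 1,(fact X)\<^sup>2,primorial X,?q,?T,0,0,0,0,0,0,0,0,0,?n,isqrt ?n,0,0,0,0,1,2])
     29 (st [N,N mod v + (2 - v) + (v + 1 - N),X + (1 - (1 - ?q)),(c + 1) * (1 - ?q),s,v,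
       0,0,0,0,0,0,0,0,0,0,0,0,0,0,0,0,0,0,0,0,0,1,2])"
    unfolding v_def
    by (rule run_blk[OF straight_blocks(9) assms(2) _ _ less5])
      (simp_all only: cand_final_def step_simps, simp)
  then have 5: "run R (wide b) (blk cand_final)
     (st [N,g,X,c,s,u,0,X + 1,(fact X)\<^sup>2,primorial X,?q,?T,0,0,0,0,0,0,0,0,0,?n,isqrt ?n,0,0,0,0,1,2])
     29 (st [N,defect N (candidate N s X c),
       if c < codes X then X else X + 1,if c < codes X then c + 1 else 0,
       s,candidate N s X c,0,0,0,0,0,0,0,0,0,0,0,0,0,0,0,0,0,0,0,0,0,1,2])"
    unfolding X' c' v defect_def .
  show ?thesis
    unfolding cand_body_def body_cost_def
    by (rule run_mono[OF run_Seq[OF 1 run_Seq[OF 2 run_Seq[OF 3 run_Seq[OF 4 5]]]]]) simp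
qed

text \<open>
  For every \<open>X\<close> the counter also takes the value \<open>codes X\<close>, whose overflowing digits trigger the
  step to \<open>X + 1\<close>.
\<close>

definition visits :: "nat \<Rightarrow> nat \<Rightarrow> nat" where
  "visits X Y = (\<Sum>x\<in>{X..Y}. codes x + 1)"

lemma visits_Suc: "X \<le> Y \<Longrightarrow> visits X Y = codes X + 1 + visits (Suc X) Y"
  unfolding visits_def by (simp add: sum.atLeast_Suc_atMost)

lemma body_cost_mono: "X \<le> Y \<Longrightarrow> body_cost b X \<le> body_cost b Y"
  unfolding body_cost_def by (intro add_le_mono mult_le_mono) auto

text \<open>Induction on the visits left until the end of round \<open>Y\<close>. The condition
  \<open>X = Y \<longrightarrow> c \<le> m\<close> says that the successful pair has not been
  passed. An earlier success also ends the loop, so the final registers are left existential and the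
  time is only bounded above.\<close>

lemma run_search:
  assumes big: "(N + s + fact Y + Y + 4)\<^sup>2 < 2 ^ b"
    and stop: "proper_factor (candidate N s Y m) N" "m < codes Y"
    and "1 \<le> X" "X \<le> Y" "c \<le> codes X" "X = Y \<longrightarrow> c \<le> m" "g \<noteq> 0" "g < 2 ^ b" "u < 2 ^ b"
  shows "\<exists>X' c' d. proper_factor d N \<and>
     (\<forall>x\<in>set [N,0,X',c',s,d,0,0,0,0,0,0,0,0,0,0,0,0,0,0,0,0,0,0,0,0,0,1,2]. x < 2 ^ b) \<and>
     run R (wide b) (While_Nonzero 1 cand_body)
     (st [N,g,X,c,s,u,0,0,0,0,0,0,0,0,0,0,0,0,0,0,0,0,0,0,0,0,0,1,2])
     ((visits X Y - c) * (body_cost b Y + 1) + 1)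
     (st [N,0,X',c',s,d,0,0,0,0,0,0,0,0,0,0,0,0,0,0,0,0,0,0,0,0,0,1,2])"
  using assms(4-)
proof (induction "visits X Y - c" arbitrary: X c g u rule: less_induct)
  case less
  let ?Q = "N + s + fact Y + Y + 4"
  let ?z = "\<lambda>N g X c s u. [N,g,X,c,s,u,0,0,0,0,0,0,0,0,0,0,0,0,0,0,0,0,0,0,0,0,0,1,2::nat]"
  have Q: "x < 2 ^ b" if "x \<le> ?Q" for x
  proof -
    have "?Q \<le> ?Q\<^sup>2" by (simp add: power2_eq_square)
    with that big show ?thesis by linarith
  qed
  have sq: "x\<^sup>2 < 2 ^ b" if "x \<le> ?Q" for x
    using power_mono[OF that, of 2] big by linarith
  have fact: "fact X \<le> (fact Y :: nat)" using less.prems by (intro fact_mono_nat)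
  have primorial: "primorial X \<le> fact X" by (rule primorial_le_fact)
  have codes: "codes X \<le> primorial X" by (rule codes_le_primorial)
  have "2\<^sup>2 < (2::nat) ^ b" using sq[of 2] by simp
  then have b: "2 \<le> b" by (metis less_imp_le_nat nat_power_less_imp_less pos2)
  have bnd: "\<forall>x\<in>set [N,g,X,c,s,u,X + 1,(fact X)\<^sup>2,(s + primorial X)\<^sup>2]. x < 2 ^ b"
    using less.prems fact primorial codes by (simp add: Q sq)
  let ?u = "candidate N s X c"
  let ?X = "if c < codes X then X else X + 1"
  let ?c = "if c < codes X then c + 1 else 0"
  have body: "run R (wide b) cand_body (st (?z N g X c s u)) (body_cost b Y)
      (st (?z N (defect N ?u) ?X ?c s ?u))"
    by (rule run_mono[OF run_cand_body[OF bnd b] body_cost_mono]) (rule less.prems)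
  have less1: "\<forall>x\<in>set (?z N g X c s u). x < 2 ^ b" using bnd by (simp add: Q)
  have u: "?u \<le> X + s + primorial X" by (rule candidate_le)
  then have u_less: "?u < 2 ^ b" using less.prems fact primorial by (intro Q) linarith
  have "visits X Y - c \<noteq> 0" using less.prems visits_Suc[of X Y] by simp
  show ?case
  proof (cases "defect N ?u = 0")
    case True
    have less2: "\<forall>x\<in>set (?z N 0 ?X ?c s ?u). x < 2 ^ b"
      using bnd u_less less.prems fact primorial codes by (simp add: Q)
    have "run R (wide b) (While_Nonzero 1 cand_body) (st (?z N 0 ?X ?c s ?u)) 1
        (st (?z N 0 ?X ?c s ?u))"
      by (rule run_While_False_st[OF less2]) simp_all
    then have "run R (wide b) (While_Nonzero 1 cand_body) (st (?z N g X c s u))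
        (1 + body_cost b Y + 1) (st (?z N 0 ?X ?c s ?u))"
      using body less.prems unfolding True by (intro run_While_True_st[OF less1]) simp_all
    moreover have "1 + body_cost b Y + 1 \<le> (visits X Y - c) * (body_cost b Y + 1) + 1"
      using \<open>visits X Y - c \<noteq> 0\<close> by (cases "visits X Y - c") auto
    ultimately show ?thesis
      using True less2 unfolding defect_eq_0_iff by (blast intro: run_mono)
  next
    case False
    have stop': "X = Y \<Longrightarrow> c \<noteq> m" using False stop(1) by (auto simp: defect_eq_0_iff)
    \<comment> \<open>Round \<open>Y\<close> cannot overflow, because
      \<open>c <= m < codes Y\<close> holds there.\<close>
    have "X \<noteq> Y" if "\<not> c < codes X"
      using that less.prems stop(2) by auto
    then have X: "?X \<le> Y" using less.prems by auto
    have c: "?c \<le> codes ?X" "?X = Y \<longrightarrow> ?c \<le> m"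
      using less.prems stop' by (auto simp: less_eq_Suc_le[symmetric] intro: le_neq_implies_less)
    have step: "visits X Y - c = Suc (visits ?X Y - ?c)"
      using less.prems X visits_Suc[of X Y] by auto
    have defect: "defect N ?u < 2 ^ b"
      using less.prems fact primorial u by (intro Q order_trans[OF defect_le]) linarith
    have lt: "visits ?X Y - ?c < visits X Y - c" unfolding step by (rule lessI)
    have one: "1 \<le> ?X" using less.prems(1) by simp
    from less.hyps[OF lt one X c False defect u_less] obtain X' c' d where d: "proper_factor d N"
      and less2: "\<forall>x\<in>set (?z N 0 X' c' s d). x < 2 ^ b"
      and r: "run R (wide b) (While_Nonzero 1 cand_body) (st (?z N (defect N ?u) ?X ?c s ?u))
        ((visits ?X Y - ?c) * (body_cost b Y + 1) + 1) (st (?z N 0 X' c' s d))"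
      by blast
    have "run R (wide b) (While_Nonzero 1 cand_body) (st (?z N g X c s u))
        (1 + body_cost b Y + ((visits ?X Y - ?c) * (body_cost b Y + 1) + 1)) (st (?z N 0 X' c' s d))"
      by (rule run_While_True_st[OF less1 _ _ body r]) (use less.prems in simp_all)
    moreover have "1 + body_cost b Y + ((visits ?X Y - ?c) * (body_cost b Y + 1) + 1) =
        (visits X Y - c) * (body_cost b Y + 1) + 1"
      unfolding step by simp
    ultimately have "run R (wide b) (While_Nonzero 1 cand_body) (st (?z N g X c s u))
        ((visits X Y - c) * (body_cost b Y + 1) + 1) (st (?z N 0 X' c' s d))"
      by (simp only:)
    then show ?thesis using d less2 by blast
  qed
qed

lemma straight_copy: "straight [Copy 0 5]"
  by (simp add: straight_def fits_def)

lemma computes_factor: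
  fixes N Y b m :: nat
  defines "s \<equiv> isqrt (4 * N - 1) + 1"
  assumes big: "(N + s + fact Y + Y + 4)\<^sup>2 < 2 ^ b"
    and stop: "proper_factor (candidate N s Y m) N" "m < codes Y"
    and "2 \<le> Y"
  shows "\<exists>d t n. computes factor_prog N t n d \<and> proper_factor d N \<and>
     t \<le> (visits 2 Y * (body_cost b Y + 1) + 30 * b + 89) * (1 + wide b)\<^sup>2 \<and>
     n \<le> card (insert 0 (regs factor_prog)) * wide b"
proof -
  let ?R = "insert 0 (regs factor_prog)"
  let ?z = "\<lambda>N g X c s u. [N,g,X,c,s,u,0,0,0,0,0,0,0,0,0,0,0,0,0,0,0,0,0,0,0,0,0,1,2::nat]"
  let ?Q = "N + s + fact Y + Y + 4"
  let ?n = "4 * N - 1"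
  have Q: "x < 2 ^ b" if "x \<le> ?Q" for x
  proof -
    have "?Q \<le> ?Q\<^sup>2" by (simp add: power2_eq_square)
    with that big show ?thesis by linarith
  qed
  have "(2::nat)\<^sup>2 \<le> ?Q\<^sup>2" by (rule power_mono) simp_all
  then have "2\<^sup>2 < (2::nat) ^ b" using big by linarith
  then have b: "2 \<le> b" by (metis less_imp_le_nat nat_power_less_imp_less pos2)
  have "4 * N - 1 \<le> (N + 4)\<^sup>2" by (simp add: power2_eq_square algebra_simps)
  also have "\<dots> \<le> ?Q\<^sup>2" by (rule power_mono) simp_all
  finally have n: "?n < 2 ^ b" using big by linarith
  have lo: "isqrt ?n < 2 ^ b" by (rule Q) (simp add: s_def)
  have init: "(\<lambda>r. if r = 0 then N else 0) =
      st [N,0,0,0,0,0,0,0,0,0,0,0,0,0,0,0,0,0,0,0,0,0,0,0,0,0,0,0,0]"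
  proof
    fix r :: reg
    show "(if r = 0 then N else 0) = st [N,0,0,0,0,0,0,0,0,0,0,0,0,0,0,0,0,0,0,0,0,0,0,0,0,0,0,0,0] r"
      by (cases r) (simp_all add: st_def nth_Cons split: nat.split)
  qed
  have "run ?R (wide b) (blk prog_init)
      (st [N,0,0,0,0,0,0,0,0,0,0,0,0,0,0,0,0,0,0,0,0,0,0,0,0,0,0,0,0]) 29
      (st [N,0,0,0,0,0,0,0,0,0,0,0,0,0,0,0,0,0,0,0,0,(2 + 2) * N - 1,0,(2 + 2) * N - 1,0,0,0,1,2])"
    by (rule run_blk[OF straight_blocks(10) b]) (simp_all only: prog_init_def step_simps, simp_all add: Q)
  then have 1: "run ?R (wide b) (blk prog_init)
      (st [N,0,0,0,0,0,0,0,0,0,0,0,0,0,0,0,0,0,0,0,0,0,0,0,0,0,0,0,0]) 29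
      (st [N,0,0,0,0,0,0,0,0,0,0,0,0,0,0,0,0,0,0,0,0,?n,0,?n,0,0,0,1,2])"
    by simp
  have "run ?R (wide b) isqrt_prog
      (st [N,0,0,0,0,0,0,0,0,0,0,0,0,0,0,0,0,0,0,0,0,?n,0,?n,0,0,0,1,2]) (30 * len ?n + 1)
      (st [N,0,0,0,0,0,0,0,0,0,0,0,0,0,0,0,0,0,0,0,0,?n,isqrt ?n,0,0,0,0,1,2])"
    unfolding isqrt_def by (rule run_isqrt_aux[OF _ b]) (use n in \<open>simp_all add: Q\<close>)
  moreover have "30 * len ?n + 1 \<le> 30 * b + 1" using n by (simp add: len_le_iff)
  ultimately have 2: "run ?R (wide b) isqrt_prog
      (st [N,0,0,0,0,0,0,0,0,0,0,0,0,0,0,0,0,0,0,0,0,?n,0,?n,0,0,0,1,2]) (30 * b + 1)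
      (st [N,0,0,0,0,0,0,0,0,0,0,0,0,0,0,0,0,0,0,0,0,?n,isqrt ?n,0,0,0,0,1,2])"
    by (rule run_mono)
  have less3: "\<forall>x\<in>set [N,0,0,0,0,0,0,0,0,0,0,0,0,0,0,0,0,0,0,0,0,?n,isqrt ?n,0,0,0,0,1,2]. x < 2 ^ b"
    using n lo by (simp add: Q)
  have 3: "run ?R (wide b) (blk prog_start)
      (st [N,0,0,0,0,0,0,0,0,0,0,0,0,0,0,0,0,0,0,0,0,?n,isqrt ?n,0,0,0,0,1,2]) 29 (st (?z N 1 2 0 s 0))"
    unfolding s_def
    by (rule run_blk[OF straight_blocks(11) b _ _ less3])
      (simp_all only: prog_start_def step_simps, simp)
  have one: "(1::nat) \<noteq> 0" "1 < (2::nat) ^ b" "0 < (2::nat) ^ b" "(1::nat) \<le> 2" "0 \<le> codes 2"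
      "2 = Y \<longrightarrow> 0 \<le> m"
    by (simp_all add: Q)
  from run_search[OF big stop one(4) assms(5) one(5,6,1,2,3), where R = ?R]
  obtain X' c' d where d: "proper_factor d N"
    and less5: "\<forall>x\<in>set (?z N 0 X' c' s d). x < 2 ^ b" and
    "run ?R (wide b) (While_Nonzero 1 cand_body) (st (?z N 1 2 0 s 0))
     ((visits 2 Y - 0) * (body_cost b Y + 1) + 1) (st (?z N 0 X' c' s d))"
    by blast
  then have 4: "run ?R (wide b) (While_Nonzero 1 cand_body) (st (?z N 1 2 0 s 0))
     (visits 2 Y * (body_cost b Y + 1) + 1) (st (?z N 0 X' c' s d))"
    by (simp only: diff_zero)
  have "run ?R (wide b) (blk [Copy 0 5]) (st (?z N 0 X' c' s d)) 29 (st (?z d 0 X' c' s d))"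
    by (rule run_blk[OF straight_copy b _ _ less5]) (simp_all only: step_simps, simp)
  then have 5: "run ?R (wide b) (Instr (Copy 0 5)) (st (?z N 0 X' c' s d)) 29 (st (?z d 0 X' c' s d))"
    by simp
  have "run ?R (wide b) factor_prog (\<lambda>r. if r = 0 then N else 0)
      (visits 2 Y * (body_cost b Y + 1) + 30 * b + 89) (st (?z d 0 X' c' s d))"
    unfolding init
    by (rule run_mono[OF run_Seq[OF 1 run_Seq[OF 2 run_Seq[OF 3 run_Seq[OF 4 5]]],
        folded factor_prog_def]]) simp
  then obtain t n where *: "exec ?R factor_prog (\<lambda>r. if r = 0 then N else 0) t n (st (?z d 0 X' c' s d))"
    "t \<le> (visits 2 Y * (body_cost b Y + 1) + 30 * b + 89) * (1 + wide b)\<^sup>2"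
    "n \<le> card ?R * wide b"
    unfolding run_def by blast
  have "st (?z d 0 X' c' s d) 0 = d" by (simp add: st_def)
  with *(1) have "computes factor_prog N t n d" unfolding computes_def by blast
  with d *(2,3) show ?thesis by blast
qed

section \<open>Counting admissible residues\<close>

text \<open>Bounds the residues with \<open>y = N / y\<close>, at which the pairing of
  \<open>y\<close> with \<open>N / y\<close> degenerates.\<close>

lemma card_square_roots_le:
  fixes p :: int
  assumes "prime p" "\<not> p dvd N"
  shows "card {y\<in>{1..<p}. p dvd y * y - N} \<le> 2"
proof (cases "{y\<in>{1..<p}. p dvd y * y - N} = {}")
  case False
  then obtain x where x: "1 \<le> x" "x < p" "p dvd x * x - N" by auto
  have "{y\<in>{1..<p}. p dvd y * y - N} \<subseteq> {x, p - x}"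
  proof
    fix y assume "y \<in> {y\<in>{1..<p}. p dvd y * y - N}"
    then have y: "1 \<le> y" "y < p" "p dvd y * y - N" by auto
    have "p dvd (y * y - N) - (x * x - N)" using y(3) x(3) by (rule dvd_diff)
    also have "(y * y - N) - (x * x - N) = (y - x) * (y + x)" by (simp add: algebra_simps)
    finally have "p dvd y - x \<or> p dvd y + x" using assms(1) by (simp add: prime_dvd_mult_iff)
    then show "y \<in> {x, p - x}"
    proof
      assume "p dvd y - x"
      then have "y = x" using x y by (smt (verit) zdvd_not_zless dvd_minus_iff)
      then show ?thesis by simp
    next
      assume "p dvd y + x"
      then have "p dvd (y + x) - p" by simp
      then have "y + x = p" using x y by (smt (verit) zdvd_not_zless dvd_minus_iff)
      then show ?thesis by simp
    qed
  qed
  then have "card {y\<in>{1..<p}. p dvd y * y - N} \<le> card {x, p - x}" by (rule card_mono[rotated]) simp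
  also have "\<dots> \<le> 2" by (simp add: card_insert_if)
  finally show ?thesis .
next
  case True
  then show ?thesis by (simp only: card.empty)
qed

text \<open>Passing to integers removes the truncated subtraction, which is exact because
  \<open>4 N <= (s + x)^2\<close>, and turns the factor \<open>p - 1\<close> back into -1.\<close>

lemma admissible_dvd:
  assumes "4 * N \<le> s\<^sup>2" "0 < p"
  shows "admissible N s p x \<longleftrightarrow> (\<exists>z<p. int p dvd (int (s + x))\<^sup>2 - 4 * int N - (int z)\<^sup>2)"
proof -
  have le: "4 * N \<le> (s + x)\<^sup>2"
    by (rule order_trans[OF assms(1)]) (simp add: power_mono)
  have "((p - 1) * z * z + ((s + x)\<^sup>2 - 4 * N) mod p) mod p = 0 \<longleftrightarrow>
      int p dvd (int (s + x))\<^sup>2 - 4 * int N - (int z)\<^sup>2" for z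
  proof -
    have "((p - 1) * z * z + ((s + x)\<^sup>2 - 4 * N) mod p) mod p = 0 \<longleftrightarrow>
        p dvd (p - 1) * z * z + ((s + x)\<^sup>2 - 4 * N)"
      by (simp add: mod_add_right_eq dvd_eq_mod_eq_0)
    also have "\<dots> \<longleftrightarrow> int p dvd int ((p - 1) * z * z + ((s + x)\<^sup>2 - 4 * N))"
      by (simp only: int_dvd_int_iff)
    also have "int ((p - 1) * z * z + ((s + x)\<^sup>2 - 4 * N)) =
        (int p - 1) * int z * int z + ((int (s + x))\<^sup>2 - 4 * int N)"
      using le assms(2) by (simp only: of_nat_add of_nat_mult of_nat_diff of_nat_power) (simp add: of_nat_diff)
    also have "\<dots> = ((int (s + x))\<^sup>2 - 4 * int N - (int z)\<^sup>2) + int p * (int z)\<^sup>2"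
      by (simp add: power2_eq_square left_diff_distrib)
    also have "int p dvd \<dots> \<longleftrightarrow> int p dvd (int (s + x))\<^sup>2 - 4 * int N - (int z)\<^sup>2"
      by (rule dvd_add_left_iff) simp
    finally show ?thesis .
  qed
  then show ?thesis by (simp only: admissible_def)
qed

text \<open>The quadratic formula modulo \<open>p\<close>: a square root of the discriminant
  \<open>S^2 - 4 N\<close> gives a root of \<open>y^2 - S y + N\<close>.\<close>

lemma admissible_imp_root:
  assumes "4 * N \<le> s\<^sup>2" "prime p" "odd p" "\<not> p dvd N" "admissible N s p x"
  shows "\<exists>y\<in>{1..<int p}. int p dvd y * (int (s + x) - y) - int N"
proof -
  let ?S = "int (s + x)"
  have p: "0 < p" using assms(2) by (rule prime_gt_0_nat)
  from assms(5) obtain z where z: "int p dvd ?S\<^sup>2 - 4 * int N - (int z)\<^sup>2"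
    using admissible_dvd[OF assms(1) p] by blast
  obtain h where h: "p = 2 * h + 1" using assms(3) by (rule oddE)
  \<comment> \<open>\<open>h + 1\<close> inverts 2 modulo \<open>p = 2 h + 1\<close>, so
    \<open>Y\<close> represents \<open>(S + z) / 2\<close>; the factor 4 below avoids
    divisions.\<close>
  define Y where "Y = (?S + int z) * (int h + 1)"
  have "2 * Y = (?S + int z) * (int p + 1)" by (simp add: Y_def h algebra_simps)
  then have "4 * (Y * (?S - Y) - int N) =
      (?S + int z) * (int p + 1) * (2 * ?S - (?S + int z) * (int p + 1)) - 4 * int N"
    by (simp add: algebra_simps) (simp add: Y_def h algebra_simps)
  also have "\<dots> = (?S\<^sup>2 - 4 * int N - (int z)\<^sup>2) +
      int p * ((?S + int z) * (?S - int z) - (int p + 1) * (?S + int z)\<^sup>2)"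
    by (simp add: algebra_simps power2_eq_square)
  finally have "int p dvd 4 * (Y * (?S - Y) - int N)"
    using z by (metis dvd_add dvd_triv_left)
  moreover have "coprime (int p) 4"
  proof -
    have "coprime (int p) (2 ^ 2)"
      using assms(3) by (simp only: coprime_power_right_iff coprime_right_2_iff_odd) simp
    then show ?thesis by simp
  qed
  ultimately have Y: "int p dvd Y * (?S - Y) - int N" by (simp only: coprime_dvd_mult_right_iff)
  define y where "y = Y mod int p"
  have "int p dvd Y - y" by (simp add: y_def)
  then have "int p dvd (Y - y) * (?S - Y - y)" by (rule dvd_mult2)
  with Y have "int p dvd (Y * (?S - Y) - int N) - (Y - y) * (?S - Y - y)" by (rule dvd_diff)
  also have "(Y * (?S - Y) - int N) - (Y - y) * (?S - Y - y) = y * (?S - y) - int N"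
    by (simp add: algebra_simps)
  finally have root: "int p dvd y * (?S - y) - int N" .
  have "y \<noteq> 0"
  proof
    assume "y = 0"
    with root have "int p dvd int N" by simp
    with assms(4) show False by (simp only: int_dvd_int_iff)
  qed
  moreover have "0 \<le> y" "y < int p" using p by (simp_all add: y_def)
  ultimately have "y \<in> {1..<int p}" by auto
  with root show ?thesis by blast
qed

text \<open>
  An admissible \<open>S = s + k M + T\<close> is the sum of two residues with product \<open>N\<close>, and every
  residue occurs in at most one such pair. The two residues coincide for at most two \<open>k\<close>.
\<close>

lemma card_admissible_le:
  assumes "4 * N \<le> s\<^sup>2" "prime p" "\<not> p dvd N" "coprime M p"
  shows "card {k\<in>{0..<p}. admissible N s p (k * M + T)} \<le> p div 2 + 1"
proof (cases "p = 2")
  case True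
  have "card {k\<in>{0..<p}. admissible N s p (k * M + T)} \<le> card {0..<p}" by (rule card_mono) auto
  with True show ?thesis by simp
next
  case False
  with assms(2) have odd: "odd p" using prime_odd_nat[of p] prime_ge_2_nat[of p] by fastforce
  have p: "prime (int p)" using assms(2) by simp
  define V where "V = {k\<in>{0..<p}. admissible N s p (k * M + T)}"
  define S where "S k = int (s + (k * M + T))" for k
  define root where "root k y \<longleftrightarrow> int p dvd y * (S k - y) - int N" for k y
  have "\<forall>k\<in>V. \<exists>y\<in>{1..<int p}. root k y"
    using admissible_imp_root[OF assms(1,2) odd assms(3)] unfolding V_def root_def S_def by blast
  then obtain f where f: "\<And>k. k \<in> V \<Longrightarrow> f k \<in> {1..<int p}" "\<And>k. k \<in> V \<Longrightarrow> root k (f k)"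
    by metis
  have nz: "\<not> int p dvd y" if "root k y" for k y
  proof
    assume "int p dvd y"
    then have "int p dvd y * (S k - y)" by (rule dvd_mult2)
    with that have "int p dvd y * (S k - y) - (y * (S k - y) - int N)"
      unfolding root_def by (rule dvd_diff[rotated])
    then have "int p dvd int N" by simp
    with assms(3) show False by (simp only: int_dvd_int_iff)
  qed
  \<comment> \<open>A residue \<open>y\<close> determines the sum \<open>y + N / y\<close>, from
    which \<open>k\<close> is recovered because \<open>M\<close> is invertible modulo
    \<open>p\<close>.\<close>
  have unique: "k = l" if "root k y" "root l y" "k < p" "l < p" for k l y
  proof -
    have "int p dvd (y * (S k - y) - int N) - (y * (S l - y) - int N)"
      using that(1,2) unfolding root_def by (rule dvd_diff)
    also have "\<dots> = y * ((int k - int l) * int M)" by (simp add: S_def algebra_simps)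
    finally have "int p dvd (int k - int l) * int M"
      using nz[OF that(1)] p by (simp add: prime_dvd_mult_iff)
    then have "int p dvd int k - int l"
      using assms(4) by (subst (asm) coprime_dvd_mult_left_iff) (auto simp: coprime_commute)
    then show ?thesis
      using that(3,4) dvd_imp_le_int[of "int k - int l" "int p"] by (cases "k = l") auto
  qed
  \<comment> \<open>The partner \<open>N / f k\<close>, written as a difference to avoid
    inverses.\<close>
  define g where "g k = (S k - f k) mod int p" for k
  have g_dvd: "int p dvd (S k - f k) - g k" for k by (simp add: g_def)
  have g: "root k (g k)" "g k \<in> {1..<int p}" if "k \<in> V" for k
  proof -
    have "int p dvd (S k - f k - g k) * (f k - g k)" using g_dvd by (rule dvd_mult2)
    with f(2)[OF that] have "int p dvd (f k * (S k - f k) - int N) - (S k - f k - g k) * (f k - g k)"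
      unfolding root_def by (rule dvd_diff)
    also have "\<dots> = g k * (S k - g k) - int N" by (simp add: algebra_simps)
    finally show r: "root k (g k)" unfolding root_def .
    from nz[OF this] have "g k \<noteq> 0" by auto
    moreover have "0 \<le> g k" "g k < int p" using prime_gt_0_nat[OF assms(2)] by (simp_all add: g_def)
    ultimately show "g k \<in> {1..<int p}" by auto
  qed
  have V: "k < p" if "k \<in> V" for k using that by (simp add: V_def)
  have "inj_on f V" "inj_on g V"
    using f(2) g(1) unique V by (auto intro!: inj_onI) metis+
  then have card: "card (f ` V) = card V" "card (g ` V) = card V" by (simp_all add: card_image)
  have fin: "finite V" by (simp add: V_def)
  have "f ` V \<inter> g ` V \<subseteq> {y\<in>{1..<int p}. int p dvd y * y - int N}"
  proof
    fix y assume "y \<in> f ` V \<inter> g ` V"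
    then obtain k l where kl: "k \<in> V" "l \<in> V" "y = f k" "y = g l" by blast
    then have "k = l" using unique f(2) g(1) V by metis
    with kl have y: "y = f k" "y = g k" by auto
    have "int p dvd (S k - f k - g k) * y" using g_dvd by (rule dvd_mult2)
    moreover have "int p dvd y * (S k - y) - int N" using f(2)[OF kl(1)] y by (simp add: root_def)
    ultimately have "int p dvd (y * (S k - y) - int N) - (S k - f k - g k) * y" by (rule dvd_diff[rotated])
    also have "\<dots> = y * y - int N" using y by (simp add: algebra_simps)
    finally show "y \<in> {y\<in>{1..<int p}. int p dvd y * y - int N}" using f(1)[OF kl(1)] y by simp
  qed
  then have "card (f ` V \<inter> g ` V) \<le> card {y\<in>{1..<int p}. int p dvd y * y - int N}"
    by (rule card_mono[rotated]) (rule finite_subset[of _ "{1..<int p}"], auto)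
  also have "\<dots> \<le> 2"
    by (rule card_square_roots_le[OF p]) (simp only: int_dvd_int_iff assms(3) not_False_eq_True)
  finally have int: "card (f ` V \<inter> g ` V) \<le> 2" .
  have "card (f ` V \<union> g ` V) \<le> card {1..<int p}"
    using f(1) g(2) by (intro card_mono) auto
  then have "card (f ` V \<union> g ` V) \<le> p - 1" by simp
  \<comment> \<open>By injectivity \<open>2 * card V\<close> is the size of the union plus that of
    the intersection, at most \<open>(p - 1) + 2\<close>; for odd \<open>p\<close> this is the
    claim.\<close>
  with int card card_Un_Int[of "f ` V" "g ` V"] fin have "2 * card V \<le> p - 1 + 2" by simp
  then show ?thesis using odd unfolding V_def by (auto elim!: oddE)
qed

section \<open>Every sum of two cofactors is found\<close>

lemma coprime_primorial: "coprime (primorial x) (prime_or_one (Suc x))"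
proof (cases "prime (Suc x)")
  case True
  then have "\<not> Suc x dvd primorial x"
  proof (induction x rule: nat.induct)
    case (Suc y)
    show ?case
    proof
      assume "Suc (Suc y) dvd primorial (Suc y)"
      then have "\<exists>p\<in>{1..Suc y}. Suc (Suc y) dvd prime_or_one p"
        using Suc.prems unfolding primorial_def by (subst (asm) prime_dvd_prod_iff) auto
      then obtain p where p: "1 \<le> p" "p \<le> Suc y" "Suc (Suc y) dvd prime_or_one p" by auto
      then have "Suc (Suc y) \<le> prime_or_one p" using prime_or_one_pos by (intro dvd_imp_le)
      with p prime_or_one_le[of p] show False by simp
    qed
  qed simp
  then show ?thesis using True by (simp add: prime_or_one_def) (metis prime_imp_coprime coprime_commute)
qed (simp add: prime_or_one_def)

lemma rank_le_half:
  assumes "4 * N \<le> s\<^sup>2" "\<not> (prime p \<and> p dvd N)" "coprime M (prime_or_one p)"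
  shows "rank N s (prime_or_one p) M T 0 \<le> prime_or_one p div 2 + 1"
proof (cases "prime p")
  case True
  with assms show ?thesis
    using card_admissible_le[OF assms(1), of p M T] by (simp add: rank_def prime_or_one_def)
next
  case False
  then show ?thesis using rank_le[of N s 1 M T 0] by (simp add: prime_or_one_def)
qed

text \<open>Multiples of \<open>codes x\<close> alter only the digits beyond level
  \<open>x\<close>.\<close>

lemma decode_add: "decode N s (c + codes x * k) x = decode N s c x"
proof (induction x arbitrary: k)
  case (Suc x)
  let ?d = "prime_or_one (Suc x) div 2 + 1"
  have "c + codes (Suc x) * k = c + codes x * (?d * k)" by (simp only: codes_Suc mult.assoc)
  moreover have "(c + codes x * (?d * k)) div codes x mod ?d = c div codes x mod ?d"
    using codes_pos[of x] by (simp only: div_mult_self2 mod_mult_self4 neq0_conv)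
  ultimately show ?case by (simp only: decode.simps Suc.IH)
qed simp

text \<open>The true offset passes at every level, as \<open>d mod P\<close> is a square root of its
  discriminant; the rank of its residue is the next digit.\<close>

lemma decode_complete:
  assumes "4 * N \<le> s\<^sup>2" "\<And>p. prime p \<Longrightarrow> p \<le> x \<Longrightarrow> \<not> p dvd N"
    and "(s + T)\<^sup>2 = 4 * N + d\<^sup>2"
  shows "\<exists>c<codes x. decode N s c x = T mod primorial x"
  using assms(2)
proof (induction x)
  case (Suc x)
  then obtain c where c: "c < codes x" "decode N s c x = T mod primorial x" by auto
  define M P where "M = primorial x" and "P = prime_or_one (Suc x)"
  define k where "k = T div M mod P"
  define i where "i = rank N s P M (T mod M) (Suc k)"
  have P: "0 < P" by (simp add: P_def prime_or_one_pos)
  then have k: "k < P" by (simp add: k_def)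
  have split: "k * M + T mod M = T mod (M * P)"
    by (simp add: k_def mod_mult2_eq mult.commute)
  have adm: "admissible N s P (k * M + T mod M)"
  proof -
    define x where "x = T mod (M * P)"
    have "int P dvd int T - int x"
      by (simp add: x_def zmod_int[symmetric] of_nat_mod) (metis dvd_mult_right dvd_triv_right mod_eq_dvd_iff mod_mod_trivial of_nat_mult of_nat_mod)
    moreover have "int P dvd int d - int (d mod P)"
      by (simp add: of_nat_mod)
    moreover have "(int (s + x))\<^sup>2 - 4 * int N - (int (d mod P))\<^sup>2 =
        (int d - int (d mod P)) * (int d + int (d mod P)) - (int T - int x) * (2 * int s + int T + int x)"
    proof -
      have "int ((s + T)\<^sup>2) = int (4 * N + d\<^sup>2)" by (simp only: assms(3))
      then show ?thesis by (simp add: power2_eq_square algebra_simps)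
    qed
    ultimately have "int P dvd (int (s + x))\<^sup>2 - 4 * int N - (int (d mod P))\<^sup>2"
      by (metis dvd_diff dvd_mult2)
    then show ?thesis
      unfolding split x_def[symmetric] admissible_dvd[OF assms(1) P] using P by (intro exI[of _ "d mod P"]) simp
  qed
  \<comment> \<open>The rank from \<open>k\<close> on counts \<open>k\<close>, whereas
    \<open>i\<close> starts above it; hence \<open>i\<close> is strictly below the digit
    base.\<close>
  have "rank N s P M (T mod M) k \<le> rank N s P M (T mod M) 0" by (rule rank_antimono) simp
  also have "\<dots> \<le> P div 2 + 1"
    unfolding P_def M_def
    by (rule rank_le_half[OF assms(1)]) (use Suc.prems[of "Suc x"] coprime_primorial in auto)
  finally have i: "i < P div 2 + 1" using rank_step[OF k, of N s M "T mod M"] adm by (simp add: i_def)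
  have "decode N s (c + codes x * i) (Suc x) = T mod primorial (Suc x)"
  proof -
    have "(c + codes x * i) div codes x = i" using c(1) codes_pos[of x] by simp
    then have "decode N s (c + codes x * i) (Suc x) = select N s P M (T mod M) i 0"
      using i c(2) by (simp add: decode_add P_def[symmetric] M_def[symmetric])
    also have "\<dots> = k * M + T mod M" unfolding i_def by (rule select_eq[OF adm k]) simp
    also have "\<dots> = T mod (M * P)" by (rule split)
    also have "M * P = primorial (Suc x)" by (simp only: primorial_Suc M_def P_def)
    finally show ?thesis .
  qed
  moreover have "c + codes x * i < codes (Suc x)"
  proof -
    have "c + codes x * i < codes x * Suc i" using c(1) by simp
    also have "\<dots> \<le> codes x * (P div 2 + 1)" using i by (intro mult_le_mono2) simp
    finally show ?thesis by (simp add: codes_Suc P_def)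
  qed
  ultimately show ?case by blast
qed auto

text \<open>By \<open>(u + v)^2 - 4 u v = (v - u)^2\<close> the right offset yields
  \<open>u\<close>; being below the primorial, this offset is its own residue.\<close>

lemma candidate_complete:
  assumes N: "N = u * v" "2 \<le> u" "u \<le> v"
    and s: "4 * N \<le> s\<^sup>2" "s \<le> u + v" "u + v < s + primorial X"
    and "\<And>x. 2 \<le> x \<Longrightarrow> x \<le> X \<Longrightarrow> \<not> x dvd N" "2 \<le> X"
  shows "\<exists>c<codes X. proper_factor (candidate N s X c) N"
proof -
  have sum: "(s + (u + v - s))\<^sup>2 = 4 * N + (v - u)\<^sup>2"
  proof -
    obtain w where w: "v = u + w" using N(3) by (rule le_Suc_ex[elim_format]) blast
    show ?thesis using s(2) unfolding N(1) w by (simp add: power2_eq_square algebra_simps)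
  qed
  obtain c where c: "c < codes X" "decode N s c X = (u + v - s) mod primorial X"
    using decode_complete[OF s(1) _ sum, of X] assms(7) prime_ge_2_nat by blast
  have "u + v - s < primorial X" using s(2,3) by linarith
  with c(2) have "decode N s c X = u + v - s" by simp
  moreover have "(s + (u + v - s))\<^sup>2 - 4 * N = (v - u)\<^sup>2" using sum by simp
  moreover have "\<not> X dvd N" using assms(7,8) by simp
  ultimately have "candidate N s X c = (s + (u + v - s) - (v - u)) div 2"
    unfolding candidate_def by (simp only: isqrt_square if_False)
  also have "\<dots> = u" using s(2) N(3) by simp
  finally have "candidate N s X c = u" .
  moreover have "proper_factor u N"
  proof -
    have "u * 1 < u * v" using N by (intro mult_strict_left_mono) auto
    then show ?thesis using N by (simp add: proper_factor_def)
  qed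
  ultimately show ?thesis using c(1) by auto
qed

section \<open>A Chebyshev bound\<close>

text \<open>
  By induction along Leibniz' harmonic triangle:
  \<open>1 / a(n, k + 1) = 1 / a(n - 1, k) - 1 / a(n, k)\<close> for \<open>a(n, k) = (n + 1) (n choose k)\<close>.
\<close>

lemma Suc_mult_binomial_dvd_Lcm:
  "k \<le> n \<Longrightarrow> Suc n * (n choose k) dvd Lcm {1..Suc n}"
proof (induction k arbitrary: n)
  case 0
  then show ?case by (auto intro: dvd_Lcm)
next
  case (Suc k)
  then obtain n' where n: "n = Suc n'" by (cases n) auto
  let ?L = "int (Lcm {1..Suc n})"
  let ?C = "int (n choose Suc k)"
  have "n * (n' choose k) dvd Lcm {1..n}" using Suc.IH[of n'] Suc.prems n by simp
  also have "Lcm {1..n} dvd Lcm {1..Suc n}" by (rule Lcm_subset) auto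
  finally have "int (n * (n' choose k)) dvd ?L" by (simp only: int_dvd_int_iff)
  then obtain x where x: "?L = int (n * (n' choose k)) * x" ..
  have "int (Suc n * (n choose k)) dvd ?L"
    using Suc.IH[of n] Suc.prems by (simp only: int_dvd_int_iff)
  then obtain y where y: "?L = int (Suc n * (n choose k)) * y" ..
  have b: "int (n * (n' choose k)) = int (Suc k) * ?C"
    unfolding n by (simp only: binomial_absorption of_nat_mult [symmetric] Suc_times_binomial diff_Suc_1)
  have c: "int (n choose k) * int (n - k) = int (Suc k) * ?C"
    using binomial_absorb_comp[of n k] binomial_absorption[of k "n - 1"] Suc.prems
    unfolding n by (simp only: of_nat_mult [symmetric] mult.commute Suc_times_binomial diff_Suc_1)
  have xL: "int (Suc k) * ?C * x = ?L" by (simp only: x b)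
  have yL: "int (Suc n) * (int (Suc k) * ?C) * y = int (n - k) * ?L"
    by (simp only: c[symmetric] y of_nat_mult mult_ac)
  have "int (Suc k) * (int (Suc n) * ?C * (x - y)) =
      int (Suc n) * (int (Suc k) * ?C * x) - int (Suc n) * (int (Suc k) * ?C) * y"
    by (simp only: algebra_simps)
  also have "\<dots> = int (Suc n) * ?L - int (n - k) * ?L" by (simp only: xL yL)
  also have "\<dots> = int (Suc k) * ?L"
    using Suc.prems by (simp add: of_nat_diff algebra_simps)
  finally have "int (Suc n) * ?C * (x - y) = ?L" by (simp del: of_nat_Suc)
  then have "int (Suc n * (n choose Suc k)) dvd ?L" by (metis dvd_triv_left of_nat_mult)
  then show ?case by (simp only: int_dvd_int_iff)
qed

definition primes_upto :: "nat \<Rightarrow> nat set" where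
  "primes_upto x = {p. prime p \<and> p \<le> x}"

lemma finite_primes_upto: "finite (primes_upto x)"
  by (rule finite_subset[of _ "{..x}"]) (auto simp: primes_upto_def)

lemma Lcm_upto_pos: "0 < Lcm {1..x::nat}"
  by (simp add: Lcm_0_iff flip: neq0_conv)

text \<open>Each prime enters the lcm with its largest power not exceeding \<open>x\<close>, hence
  contributes a factor of at most \<open>x\<close>.\<close>

lemma Lcm_upto_le: "Lcm {1..x} \<le> x ^ card (primes_upto x)"
proof -
  \<comment> \<open>\<open>floorlog\<close> counts digits, one more than the exponent of the largest
    power up to \<open>x\<close>.\<close>
  define e where "e p = floorlog p x - 1" for p
  let ?Q = "\<Prod>p\<in>primes_upto x. p ^ e p"
  have pow_le: "p ^ e p \<le> x" if "p \<in> primes_upto x" for p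
    using that floorlog_bounds[of x p] prime_gt_1_nat[of p] by (auto simp: primes_upto_def e_def)
  have "Lcm {1..x} dvd ?Q"
  proof (rule Lcm_least)
    fix i assume i: "i \<in> {1..x}"
    have "i = (\<Prod>p\<in>prime_factors i. p ^ multiplicity p i)"
      using i by (intro prime_factorization_nat) simp
    also have "\<dots> dvd ?Q"
    proof (rule prod_dvd_prod_subset2[OF finite_primes_upto])
      show "prime_factors i \<subseteq> primes_upto x"
        using i by (auto simp: primes_upto_def prime_factors_dvd dest!: dvd_imp_le)
      fix p assume p: "p \<in> prime_factors i"
      then have "prime p" by auto
      then have p1: "1 < p" by (rule prime_gt_1_nat)
      have "p ^ multiplicity p i \<le> i" using i by (intro dvd_imp_le multiplicity_dvd) simp
      also have "i \<le> x" using i by simp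
      also have "x < p ^ floorlog p x" using floorlog_bounds[of x p] i p1 by simp
      finally have "multiplicity p i < floorlog p x" using p1 by simp
      then show "p ^ multiplicity p i dvd p ^ e p" by (intro le_imp_power_dvd) (simp add: e_def)
    qed
    finally show "i dvd ?Q" .
  qed
  moreover have "0 < ?Q" by (rule prod_pos) (auto simp: primes_upto_def prime_gt_0_nat)
  ultimately have "Lcm {1..x} \<le> ?Q" by (rule dvd_imp_le)
  also have "\<dots> \<le> (\<Prod>p\<in>primes_upto x. x)" by (intro prod_mono) (use pow_le in auto)
  finally show ?thesis by simp
qed

text \<open>Nair's argument: \<open>(2 m + 1) * (2 m choose m)\<close> divides the lcm of the
  numbers up to \<open>2 m + 1\<close> and is at least \<open>4^m\<close>.\<close>

lemma four_power_le:
  assumes "2 * m + 1 \<le> x"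
  shows "4 ^ m \<le> x ^ card (primes_upto x)"
proof (cases "m = 0")
  case True
  then show ?thesis using assms by simp
next
  case False
  have "4 ^ m / (2 * real m) \<le> real (2 * m choose m)"
    by (rule central_binomial_lower_bound) (use False in simp)
  then have "4 ^ m \<le> real (2 * m * (2 * m choose m))" using False by (simp add: field_simps)
  also have "\<dots> \<le> real (Suc (2 * m) * (2 * m choose m))" by simp
  finally have "4 ^ m \<le> Suc (2 * m) * (2 * m choose m)"
    by (metis of_nat_le_iff of_nat_numeral of_nat_power)
  also have "\<dots> \<le> Lcm {1..Suc (2 * m)}"
    by (rule dvd_imp_le[OF Suc_mult_binomial_dvd_Lcm Lcm_upto_pos]) simp
  also have "\<dots> \<le> Lcm {1..x}"
    using assms by (intro dvd_imp_le Lcm_subset Lcm_upto_pos) auto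
  also note Lcm_upto_le
  finally show ?thesis .
qed

lemma card_primes_upto_Suc:
  "card (primes_upto (Suc x)) = card (primes_upto x) + (if prime (Suc x) then 1 else 0)"
proof -
  have "primes_upto (Suc x) = (if prime (Suc x) then insert (Suc x) else id) (primes_upto x)"
    by (auto simp: primes_upto_def le_Suc_eq)
  moreover have "Suc x \<notin> primes_upto x" by (simp add: primes_upto_def)
  ultimately show ?thesis using finite_primes_upto[of x] by simp
qed

lemma card_primes_upto_0: "card (primes_upto 0) = 0"
  by (auto simp: primes_upto_def)

text \<open>Limits the number of primes below \<open>Y\<close> to \<open>2 ln D\<close>. Being crude
  here costs a factor \<open>ln Y\<close> in the bound on \<open>Y\<close>, hence only a lower-order
  term in \<open>log_bound\<close>.\<close>

lemma two_power_le_primorial: "2 ^ card (primes_upto x) \<le> primorial x"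
proof (induction x)
  case (Suc x)
  have "2 ^ (if prime (Suc x) then 1 else 0) \<le> prime_or_one (Suc x)"
    using prime_ge_2_nat[of "Suc x"] by (auto simp: prime_or_one_def)
  with Suc have "2 ^ card (primes_upto x) * 2 ^ (if prime (Suc x) then 1 else 0) \<le> primorial x * prime_or_one (Suc x)"
    by (rule mult_le_mono)
  then show ?case by (simp only: card_primes_upto_Suc power_add primorial_Suc)
qed (simp add: card_primes_upto_0)

lemma primorial_le_power: "primorial x \<le> x ^ card (primes_upto x)"
proof (induction x)
  case (Suc x)
  have "x ^ card (primes_upto x) \<le> Suc x ^ card (primes_upto x)" by (rule power_mono) auto
  with Suc have "primorial x \<le> Suc x ^ card (primes_upto x)" by simp
  moreover have "prime_or_one (Suc x) \<le> Suc x ^ (if prime (Suc x) then 1 else 0)"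
    by (simp add: prime_or_one_def)
  ultimately have "primorial x * prime_or_one (Suc x) \<le>
      Suc x ^ card (primes_upto x) * Suc x ^ (if prime (Suc x) then 1 else 0)"
    by (rule mult_le_mono)
  then show ?case by (simp only: card_primes_upto_Suc power_add primorial_Suc)
qed (simp add: card_primes_upto_0)

text \<open>Rounding the base up from \<open>p / 2\<close> costs a factor of at most
  \<open>1 + 2 / p\<close>. Even over all integers up to \<open>x\<close> these factors multiply to
  \<open>(x + 1) (x + 2) / 2\<close>, which \<open>(x + 1)^2\<close> covers.\<close>

lemma codes_mult_two_power_le: "codes x * 2 ^ card (primes_upto x) \<le> (x + 1)\<^sup>2 * primorial x"
proof (induction x)
  case (Suc x)
  show ?case
  proof (cases "prime (Suc x)")
    case True
    have "codes (Suc x) * 2 ^ card (primes_upto (Suc x)) =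
        (codes x * 2 ^ card (primes_upto x)) * (2 * (Suc x div 2 + 1))"
      using True
      by (simp only: codes_Suc card_primes_upto_Suc prime_or_one_def if_True power_add power_one_right mult_ac)
    also have "\<dots> \<le> ((x + 1)\<^sup>2 * primorial x) * (x + 3)"
      by (intro mult_le_mono Suc.IH) simp
    also have "\<dots> = ((x + 1) * (x + 3)) * (primorial x * Suc x)"
      by (simp add: power2_eq_square algebra_simps)
    also have "\<dots> \<le> (Suc x + 1)\<^sup>2 * (primorial x * Suc x)"
      by (intro mult_le_mono1) (simp add: power2_eq_square algebra_simps)
    finally show ?thesis using True by (simp add: primorial_Suc prime_or_one_def)
  next
    case False
    then have eq: "codes (Suc x) * 2 ^ card (primes_upto (Suc x)) = codes x * 2 ^ card (primes_upto x)"
      "primorial (Suc x) = primorial x"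
      by (simp_all add: codes_Suc primorial_Suc prime_or_one_def card_primes_upto_Suc)
    have "(x + 1)\<^sup>2 * primorial x \<le> (Suc x + 1)\<^sup>2 * primorial x"
      by (intro mult_le_mono1 power_mono) auto
    with Suc.IH show ?thesis unfolding eq by (rule order_trans)
  qed
qed (simp add: card_primes_upto_0)

section \<open>The final round\<close>

text \<open>The logarithm of \<open>ln D * (56 + 14 ln (ln D))\<close>. Its second summand has order
  \<open>ln (ln (ln D))\<close>, so \<open>ln (ln D) / log_bound D\<close> tends to 1.\<close>

definition log_bound :: "real \<Rightarrow> real" where
  "log_bound D = ln (ln D) + ln (56 + 14 * ln (ln D))"

lemma ln_2_ge_half: "1 / 2 \<le> ln (2::real)"
proof -
  have "exp (1::real) \<le> 2 ^ 2" using exp_le by simp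
  then have "1 \<le> ln ((2::real) ^ 2)" by (subst ln_ge_iff) simp_all
  also have "ln ((2::real) ^ 2) = 2 * ln 2" using ln_realpow[of "2::real" 2] by simp
  finally show ?thesis by simp
qed

lemma ln_ge_2:
  assumes "16 \<le> (D::real)"
  shows "2 \<le> ln D"
proof -
  have "2 \<le> 4 * ln (2::real)" using ln_2_ge_half by simp
  also have "\<dots> = ln (2 ^ 4)" by (simp only: ln_realpow)
  also have "\<dots> \<le> ln D" using assms by (subst ln_le_cancel_iff) simp_all
  finally show ?thesis .
qed

lemma ln_ln_ge:
  assumes "16 \<le> (D::real)"
  shows "ln 2 \<le> ln (ln D)"
  using ln_ge_2[OF assms] by (subst ln_le_cancel_iff) simp_all

lemma log_bound_ge:
  assumes "16 \<le> D"
  shows "ln (ln D) \<le> log_bound D"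
  using ln_ln_ge[OF assms] ln_2_ge_half unfolding log_bound_def by (simp add: ln_ge_zero)

text \<open>A bootstrap: the bound on the number of primes and the Chebyshev bound give
  \<open>Y <= 7 ln D ln Y\<close>. Inserting \<open>ln Y <= 2 sqrt Y\<close> yields the first claim,
  and its logarithm, put back into the same inequality, the second.\<close>

lemma cutoff_bounds:
  assumes "2 \<le> Y" "16 \<le> D" "real (primorial (Y - 1)) \<le> D"
  shows "real Y \<le> 196 * (ln D)\<^sup>2" "ln (real Y) \<le> log_bound D"
proof -
  define x where "x = Y - 1"
  define m where "m = (x - 1) div 2"
  define n where "n = card (primes_upto x)"
  have x: "1 \<le> x" "x \<le> Y" using assms(1) by (auto simp: x_def)
  have m: "2 * m + 1 \<le> x" using x unfolding m_def by linarith
  have "x \<le> 2 * m + 2" unfolding m_def by linarith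
  then have Y: "real Y \<le> 3 + 2 * real m" using assms(1) unfolding x_def by linarith
  note lD = ln_ge_2[OF assms(2)] and lh = ln_2_ge_half
  have lY: "1 / 2 \<le> ln (real Y)"
  proof -
    have "ln 2 \<le> ln (real Y)" using assms(1) by (subst ln_le_cancel_iff) simp_all
    with lh show ?thesis by simp
  qed
  have "real (2 ^ n) \<le> real (primorial x)"
    unfolding n_def of_nat_le_iff by (rule two_power_le_primorial)
  then have "2 ^ n \<le> D" using assms(3) unfolding x_def of_nat_power of_nat_numeral by linarith
  then have "ln (2 ^ n) \<le> ln D" using assms(2) by (subst ln_le_cancel_iff) simp_all
  then have "real n * ln 2 \<le> ln D" by (simp only: ln_realpow)
  moreover have "real n * (1 / 2) \<le> real n * ln 2" using lh by (intro mult_left_mono) simp_all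
  ultimately have n: "real n \<le> 2 * ln D" by linarith
  have "real (4 ^ m) \<le> real (x ^ n)"
    unfolding n_def of_nat_le_iff by (rule four_power_le[OF m])
  also have "\<dots> \<le> real Y ^ n" using x by (simp add: power_mono)
  finally have "ln (4 ^ m) \<le> ln (real Y ^ n)" using assms(1) by (subst ln_le_cancel_iff) simp_all
  then have "real m * ln 4 \<le> real n * ln (real Y)" using assms(1) by (simp add: ln_realpow)
  moreover have "1 \<le> ln (4::real)" using lh ln_realpow[of "2::real" 2] by simp
  then have "real m * 1 \<le> real m * ln 4" by (intro mult_left_mono) simp_all
  moreover have "real n * ln (real Y) \<le> 2 * ln D * ln (real Y)"
    using n lY by (intro mult_right_mono) simp_all
  ultimately have "real m \<le> 2 * ln D * ln (real Y)" by linarith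
  \<comment> \<open>As \<open>ln D * ln Y >= 1\<close>, the 3 in \<open>Y <= 3 + 2 m\<close> is
    absorbed: \<open>7 = 3 + 2 * 2\<close>.\<close>
  moreover have "2 * (1 / 2) \<le> ln D * ln (real Y)" using lD lY by (intro mult_mono) simp_all
  ultimately have Y7: "real Y \<le> 7 * ln D * ln (real Y)" using Y by simp
  have "ln (real Y) = 2 * ln (sqrt (real Y))" using assms(1) by (simp add: ln_sqrt)
  also have "\<dots> \<le> 2 * sqrt (real Y)" using assms(1) by (simp add: ln_bound)
  finally have "7 * ln D * ln (real Y) \<le> 7 * ln D * (2 * sqrt (real Y))"
    using lD by (intro mult_left_mono) simp_all
  with Y7 have "sqrt (real Y) * sqrt (real Y) \<le> (14 * ln D) * sqrt (real Y)" by simp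
  moreover have "0 < sqrt (real Y)" using assms(1) by simp
  ultimately have sq: "sqrt (real Y) \<le> 14 * ln D" by (rule mult_right_le_imp_le)
  have "real Y = (sqrt (real Y))\<^sup>2" by simp
  also have "\<dots> \<le> (14 * ln D)\<^sup>2" using sq by (intro power_mono) simp_all
  finally show Y196: "real Y \<le> 196 * (ln D)\<^sup>2" by (simp add: power_mult_distrib)
  \<comment> \<open>Rounding 196 up to \<open>2^8\<close> and using \<open>ln 2 <= 1\<close> gives
    the 8 in \<open>7 * (8 + 2 ln (ln D)) = 56 + 14 ln (ln D)\<close>.\<close>
  also have "\<dots> \<le> 2 ^ 8 * (ln D)\<^sup>2" by (intro mult_right_mono) simp_all
  finally have "ln (real Y) \<le> ln (2 ^ 8 * (ln D)\<^sup>2)"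
    using assms(1) lD by (subst ln_le_cancel_iff) simp_all
  also have "\<dots> = ln (2 ^ 8) + ln ((ln D)\<^sup>2)" using lD by (intro ln_mult_pos) simp_all
  also have "\<dots> = 8 * ln 2 + 2 * ln (ln D)" using lD by (simp add: ln_realpow del: power_numeral)
  also have "\<dots> \<le> 8 + 2 * ln (ln D)" using ln_le_minus_one[of "2::real"] by simp
  finally have "7 * ln D * ln (real Y) \<le> 7 * ln D * (8 + 2 * ln (ln D))"
    using lD by (intro mult_left_mono) simp_all
  with Y7 have "real Y \<le> ln D * (56 + 14 * ln (ln D))" by (simp add: algebra_simps)
  moreover have pos: "0 < 56 + 14 * ln (ln D)" using ln_ln_ge[OF assms(2)] lh by simp
  ultimately have "ln (real Y) \<le> ln (ln D * (56 + 14 * ln (ln D)))"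
    using assms(1) lD by (subst ln_le_cancel_iff) simp_all
  also have "\<dots> = log_bound D"
    unfolding log_bound_def using pos lD by (intro ln_mult_pos) simp_all
  finally show "ln (real Y) \<le> log_bound D" .
qed

text \<open>There are \<open>n >= q / ln Y >= q / h\<close> primes up to \<open>Y\<close>, each
  saving a factor 2, so the exponent is at most \<open>q (1 - ln 2 / h)\<close>. As
  \<open>h >= ln 2\<close>, this grows with \<open>q\<close>, and \<open>q <= ln D + ln Y\<close>
  because the last level multiplies the primorial by at most \<open>Y\<close>.\<close>

lemma codes_bound:
  assumes "2 \<le> Y" "16 \<le> D" "real (primorial (Y - 1)) \<le> D"
  shows "real (codes Y) \<le> 4 * real Y ^ 3 * (D * exp (- (ln 2 * ln D / log_bound D)))"
proof -
  define h where "h = log_bound D"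
  define n where "n = card (primes_upto Y)"
  define q where "q = ln (real (primorial Y))"
  have q: "0 \<le> q" using primorial_pos[of Y] by (simp add: q_def ln_ge_zero)
  have lnY: "0 \<le> ln (real Y)" using assms(1) by (simp add: ln_ge_zero)
  have h: "ln 2 \<le> h"
    using log_bound_ge[OF assms(2)] ln_ln_ge[OF assms(2)] by (simp add: h_def)
  then have h0: "0 < h" using ln_2_ge_half by simp
  have "real (primorial Y) \<le> real (Y ^ n)" unfolding n_def of_nat_le_iff by (rule primorial_le_power)
  then have "q \<le> ln (real Y ^ n)"
    unfolding q_def using primorial_pos[of Y] assms(1) by (subst ln_le_cancel_iff) simp_all
  also have "\<dots> = real n * ln (real Y)" using assms(1) by (simp add: ln_realpow)
  also have "\<dots> \<le> real n * h"
    using cutoff_bounds(2)[OF assms] by (intro mult_left_mono) (simp_all add: h_def)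
  finally have qn: "q / h \<le> real n" using h0 by (simp add: field_simps)
  have "Y = Suc (Y - 1)" using assms(1) by simp
  then have "primorial Y = primorial (Y - 1) * prime_or_one Y" using primorial_Suc[of "Y - 1"] by simp
  also have "\<dots> \<le> primorial (Y - 1) * Y" using prime_or_one_le[of Y] assms(1) by (intro mult_le_mono2) simp
  finally have "real (primorial Y) \<le> real (primorial (Y - 1)) * real Y" by (simp flip: of_nat_mult)
  also have "\<dots> \<le> D * real Y" using assms(3) by (intro mult_right_mono) simp_all
  finally have "q \<le> ln (D * real Y)"
    unfolding q_def using primorial_pos[of Y] assms(1,2) by (subst ln_le_cancel_iff) simp_all
  also have "\<dots> = ln D + ln (real Y)" using assms(1,2) by (intro ln_mult_pos) simp_all
  finally have qD: "q \<le> ln D + ln (real Y)" .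
  have r: "0 \<le> 1 - ln 2 / h" "ln 2 / h \<ge> 0" using h h0 by (simp_all add: field_simps)
  have "real (codes Y * 2 ^ n) \<le> real ((Y + 1)\<^sup>2 * primorial Y)"
    unfolding n_def of_nat_le_iff by (rule codes_mult_two_power_le)
  then have "real (codes Y) * 2 ^ n \<le> (real Y + 1)\<^sup>2 * exp q"
    using primorial_pos[of Y] by (simp add: q_def add.commute)
  moreover have "2 ^ n = exp (real n * ln 2)" by (simp add: exp_of_nat_mult)
  ultimately have "real (codes Y) \<le> (real Y + 1)\<^sup>2 * exp q / exp (real n * ln 2)"
    by (simp add: pos_le_divide_eq)
  also have "\<dots> = (real Y + 1)\<^sup>2 * exp (q - real n * ln 2)" by (simp add: exp_diff)
  also have "\<dots> \<le> (real Y + 1)\<^sup>2 * exp (ln (real Y) + (ln D - ln 2 * ln D / h))"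
  proof -
    have "q / h * ln 2 \<le> real n * ln 2" using qn by (intro mult_right_mono) simp_all
    then have "q - real n * ln 2 \<le> q * (1 - ln 2 / h)" by (simp add: right_diff_distrib)
    also have "\<dots> \<le> (ln D + ln (real Y)) * (1 - ln 2 / h)"
      using qD r by (intro mult_right_mono) simp_all
    also have "\<dots> = ln (real Y) + (ln D - ln 2 * ln D / h) - ln (real Y) * (ln 2 / h)"
      by (simp add: algebra_simps add_divide_distrib)
    also have "\<dots> \<le> ln (real Y) + (ln D - ln 2 * ln D / h)"
      using mult_nonneg_nonneg[OF lnY r(2)] by linarith
    finally show ?thesis by (intro mult_left_mono) simp_all
  qed
  also have "exp (ln (real Y) + (ln D - ln 2 * ln D / h)) = real Y * (D * exp (- (ln 2 * ln D / h)))"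
    using assms(1,2) by (simp add: exp_add exp_diff exp_minus field_simps)
  also have "(real Y + 1)\<^sup>2 * \<dots> \<le> (2 * real Y)\<^sup>2 * \<dots>"
    using assms(1,2) by (intro mult_right_mono power_mono) simp_all
  also have "\<dots> = 4 * real Y ^ 3 * (D * exp (- (ln 2 * ln D / h)))"
    by (simp add: power2_eq_square power3_eq_cube)
  finally show ?thesis by (simp add: h_def)
qed

section \<open>Cofactor sums and the round that succeeds\<close>

lemma Delta_factorisation:
  assumes "composite N"
  obtains u v where "N = u * v" "2 \<le> u" "u \<le> v" "Delta N = (real u - real v)\<^sup>2 / (4 * sqrt (real N))"
proof -
  have N: "0 < N" using assms by (simp add: composite_def)
  have "Delta N \<in> Delta_set N"
    unfolding Delta_def by (rule Min_in[OF finite_Delta_set[OF N] Delta_set_nonempty[OF assms]])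
  then obtain u v where uv: "Delta N = (real u - real v)\<^sup>2 / (4 * sqrt (real N))" "N = u * v"
    "u \<noteq> 1" "v \<noteq> 1"
    unfolding Delta_set_def by blast
  then have "2 \<le> u" "2 \<le> v" using N by (cases u; cases v; simp)+
  with uv that[of u v] that[of v u] show ?thesis
    by (cases "u \<le> v") (simp_all add: power2_commute mult.commute)
qed

text \<open>With \<open>a\<close>, \<open>b\<close> the square roots of \<open>u\<close>,
  \<open>v\<close>, the sides are \<open>(a - b)^2\<close> and
  \<open>(a - b)^2 (a + b)^2 / (4 a b)\<close>; after clearing the denominator they differ by
  \<open>(a - b)^4\<close>.\<close>

lemma sum_minus_sqrt_le:
  assumes "N = u * v" "0 < N"
  shows "real (u + v) - 2 * sqrt (real N) \<le> (real u - real v)\<^sup>2 / (4 * sqrt (real N))"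
proof -
  define a b where "a = sqrt (real u)" and "b = sqrt (real v)"
  have sq: "real u = a\<^sup>2" "real v = b\<^sup>2" by (simp_all add: a_def b_def)
  have ab: "sqrt (real N) = a * b" using assms(1) by (simp add: a_def b_def real_sqrt_mult)
  have "0 < a" "0 < b" using assms by (simp_all add: a_def b_def)
  then have "0 < a * b" by simp
  have "0 \<le> (a - b)\<^sup>2 * (a - b)\<^sup>2" by simp
  then have "(a\<^sup>2 + b\<^sup>2 - 2 * (a * b)) * (4 * (a * b)) \<le> (a\<^sup>2 - b\<^sup>2)\<^sup>2"
    by (simp add: power2_eq_square algebra_simps)
  then show ?thesis unfolding ab of_nat_add sq using \<open>0 < a * b\<close> by (simp add: pos_le_divide_eq)
qed

text \<open>\<open>Y\<close> is the first \<open>X >= 2\<close> that divides \<open>N\<close> or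
  whose primorial exceeds the offset of the extremal sum \<open>u + v\<close>. The smaller cofactor
  \<open>u\<close> qualifies, so \<open>Y <= u\<close> and a divisor \<open>Y\<close> is proper;
  otherwise minimality excludes all divisors up to \<open>Y\<close>, as the halving
  requires.\<close>

lemma cutoff_exists:
  assumes "composite N"
  defines "s \<equiv> isqrt (4 * N - 1) + 1"
  shows "\<exists>Y m. 2 \<le> Y \<and> real (primorial (Y - 1)) \<le> Delta16 N \<and> m < codes Y \<and>
     proper_factor (candidate N s Y m) N"
proof -
  obtain u v where uv: "N = u * v" "2 \<le> u" "u \<le> v"
    and Delta: "Delta N = (real u - real v)\<^sup>2 / (4 * sqrt (real N))"
    using Delta_factorisation[OF assms(1)] .
  have N: "0 < N" using assms(1) by (simp add: composite_def)
  have s4: "4 * N \<le> s\<^sup>2" using isqrt_bounds(2)[of "4 * N - 1"] by (simp add: s_def)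
  have "(s - 1)\<^sup>2 < 4 * N" using isqrt_bounds(1)[of "4 * N - 1"] N by (simp add: s_def)
  also have "4 * N \<le> (u + v)\<^sup>2"
  proof -
    obtain w where w: "v = u + w" using uv(3) by (rule le_Suc_ex[elim_format]) blast
    show ?thesis unfolding uv(1) w by (simp add: power2_eq_square algebra_simps)
  qed
  finally have "s - 1 < u + v" by (rule power_less_imp_less_base) simp
  then have sle: "s \<le> u + v" by simp
  define T where "T = u + v - s"
  have "2 * sqrt (real N) = sqrt (real (4 * N))" by (simp add: real_sqrt_mult)
  also have "\<dots> \<le> sqrt (real (s\<^sup>2))" using s4 by (simp only: real_sqrt_le_iff of_nat_le_iff)
  also have "\<dots> = real s" by simp
  finally have "real T \<le> Delta N"
    using sum_minus_sqrt_le[OF uv(1) N] sle by (simp add: T_def Delta of_nat_diff)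
  then have T: "real T \<le> Delta16 N" by (simp add: Delta16_def)
  define good where "good X \<longleftrightarrow> 2 \<le> X \<and> (X dvd N \<or> T < primorial X)" for X
  have gu: "good u" using uv by (simp add: good_def)
  define Y where "Y = (LEAST X. good X)"
  have Y: "good Y" unfolding Y_def using gu by (rule LeastI)
  have least: "\<not> good X" if "X < Y" for X using that unfolding Y_def by (rule not_less_Least)
  have Y2: "2 \<le> Y" using Y by (simp add: good_def)
  \<comment> \<open>Minimality bounds the primorial at \<open>Y - 1\<close> only if
    \<open>Y - 1 >= 2\<close>; for \<open>Y = 2\<close> that primorial is 1.\<close>
  have primorial: "real (primorial (Y - 1)) \<le> Delta16 N"
  proof (cases "Y = 2")
    case True
    then have "primorial (Y - 1) = 1" by (simp add: primorial_def prime_or_one_def)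
    then show ?thesis by (simp add: Delta16_def)
  next
    case False
    then have "primorial (Y - 1) \<le> T" using least[of "Y - 1"] Y2 by (auto simp: good_def)
    then have "real (primorial (Y - 1)) \<le> real T" by (simp only: of_nat_le_iff)
    with T show ?thesis by linarith
  qed
  have "\<exists>m<codes Y. proper_factor (candidate N s Y m) N"
  proof (cases "Y dvd N")
    case True
    have "Y \<le> u" unfolding Y_def using gu by (rule Least_le)
    moreover have "u * 1 < u * v" using uv by (intro mult_strict_left_mono) auto
    then have "u < N" by (simp only: mult_1_right uv(1))
    ultimately have "proper_factor Y N" using True Y2 by (simp add: proper_factor_def)
    then have "proper_factor (candidate N s Y 0) N" using True by (simp add: candidate_def)
    then show ?thesis using codes_pos by blast
  next
    case False
    have "u + v < s + primorial Y" using Y False sle by (auto simp: good_def T_def)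
    moreover have "\<not> x dvd N" if "2 \<le> x" "x \<le> Y" for x
      using least[of x] that False by (cases "x = Y") (auto simp: good_def)
    ultimately show ?thesis using candidate_complete[OF uv s4 sle] Y2 by blast
  qed
  with Y2 primorial show ?thesis by blast
qed

section \<open>Cost\<close>

lemma ln_ge_1:
  assumes "composite N"
  shows "1 \<le> ln (real N)"
proof -
  obtain u v where "N = u * v" "2 \<le> u" "2 \<le> v"
    using Delta_factorisation[OF assms] by (metis le_trans)
  then have "4 \<le> N" using mult_le_mono[of 2 u 2 v] by simp
  then have "exp 1 \<le> real N" using exp_le by linarith
  then show ?thesis using \<open>4 \<le> N\<close> by (subst ln_ge_iff) simp_all
qed

lemma len_le_ln:
  assumes "composite N"
  shows "real (len N) \<le> 4 * ln (real N)"
proof -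
  have N: "0 < N" using assms by (simp add: composite_def)
  then have "len N \<noteq> 0" by (simp add: floorlog_eq_zero_iff)
  then have "real (len N) = real (len N - 1) + 1" by simp
  moreover have "2 ^ (len N - 1) \<le> N" using floorlog_bounds[of N 2] N by simp
  then have "2 ^ (len N - 1) \<le> real N" by (metis of_nat_le_iff of_nat_numeral of_nat_power)
  then have "ln (2 ^ (len N - 1)) \<le> ln (real N)" using N by (subst ln_le_cancel_iff) simp_all
  then have "real (len N - 1) * ln 2 \<le> ln (real N)" by (simp only: ln_realpow)
  moreover have "real (len N - 1) * (1 / 2) \<le> real (len N - 1) * ln 2"
    using ln_2_ge_half by (intro mult_left_mono) simp_all
  ultimately show ?thesis using ln_ge_1[OF assms] by linarith
qed

text \<open>\<open>Y!\<close> is at most \<open>2^(Y^2)\<close>. The sum stays below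
  \<open>16 * 2^(len N + Y * Y)\<close>, whence the 4 extra bits, and squaring doubles the
  length.\<close>

lemma bits_suffice:
  assumes "s \<le> 4 * N" "0 < N"
  shows "(N + s + fact Y + Y + 4)\<^sup>2 < (2::nat) ^ (2 * (len N + Y * Y + 4))"
proof -
  let ?P = "(2::nat) ^ (len N + Y * Y)"
  have N: "N < 2 ^ len N" using len_le_iff[of N "len N"] by simp
  have P: "?P = 2 ^ len N * 2 ^ (Y * Y)" by (rule power_add)
  have "(2::nat) ^ len N * 1 \<le> ?P" unfolding P by (intro mult_le_mono) simp_all
  with N have NP: "N < ?P" by linarith
  have "1 * 2 ^ (Y * Y) \<le> ?P" unfolding P by (intro mult_le_mono) simp_all
  then have YP: "2 ^ (Y * Y) \<le> ?P" by simp
  have "fact Y \<le> Y ^ Y" by (metis fact_le_power le_refl of_nat_id)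
  also have "\<dots> \<le> (2 ^ Y) ^ Y" by (rule power_mono) (simp_all add: less_imp_le)
  also have "\<dots> = 2 ^ (Y * Y)" by (simp add: power_mult)
  finally have F: "fact Y \<le> ?P" using YP by linarith
  have "Y \<le> Y * Y" by simp
  also have "\<dots> \<le> 2 ^ (Y * Y)" by (rule less_imp_le) simp
  finally have Y: "Y \<le> ?P" using YP by linarith
  have "N + s + fact Y + Y + 4 < 16 * ?P" using assms NP F Y by linarith
  also have "\<dots> = 2 ^ (len N + Y * Y + 4)" by (simp add: power_add)
  finally have "N + s + fact Y + Y + 4 < 2 ^ (len N + Y * Y + 4)" .
  then have "(N + s + fact Y + Y + 4)\<^sup>2 < (2 ^ (len N + Y * Y + 4))\<^sup>2"
    by (intro power_strict_mono) simp_all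
  also have "\<dots> = 2 ^ (2 * (len N + Y * Y + 4))" by (simp only: power_mult[symmetric] mult.commute)
  finally show ?thesis .
qed

text \<open>Monotonicity of \<open>codes\<close> gives \<open>visits 2 Y <= 2 Y codes Y\<close>. The
  power \<open>2^79\<close> collects \<open>2^10\<close> from the step count, \<open>2^60\<close>
  from \<open>(1 + wide b)^2\<close> and \<open>8^3\<close> from
  \<open>b <= 8 a Y^2\<close>.\<close>

lemma steps_le:
  assumes "2 \<le> Y" "1 \<le> a" "b = 2 * (a + Y * Y + 4)"
  shows "(visits 2 Y * (body_cost b Y + 1) + 30 * b + 89) * (1 + wide b)\<^sup>2
    \<le> 2 ^ 79 * (a ^ 3 * Y ^ 10 * codes Y)"
    and "wide b \<le> 2 ^ 32 * (a * Y\<^sup>2)"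
proof -
  define r where "r = codes Y"
  have r: "1 \<le> r" using codes_pos[of Y] by (simp add: r_def)
  define y z where "y = Y * Y" and "z = a * y"
  have "4 \<le> y" using mult_le_mono[OF assms(1,1)] by (simp add: y_def)
  have "y \<le> z" "a \<le> z" using assms(1,2) by (simp_all add: y_def z_def)
  with \<open>4 \<le> y\<close> have "a + y + 4 \<le> z + z + z" by (intro add_mono) auto
  also have "\<dots> \<le> 4 * z" by simp
  finally have "2 * (a + y + 4) \<le> 2 * (4 * z)" by (rule mult_le_mono2)
  then have "b \<le> 8 * z" by (simp add: assms(3) y_def)
  then have b: "b \<le> 8 * (a * Y\<^sup>2)" by (simp add: z_def y_def power2_eq_square)
  have b2: "2 \<le> b" by (simp add: assms(3))
  have "visits 2 Y \<le> (\<Sum>x\<in>{2..Y}. 2 * r)"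
    unfolding visits_def
  proof (rule sum_mono)
    fix x assume "x \<in> {2..Y}"
    then have "codes x \<le> r" unfolding r_def by (intro codes_mono) simp
    with r show "codes x + 1 \<le> 2 * r" by linarith
  qed
  also have "\<dots> \<le> Y * (2 * r)" by simp
  finally have v: "visits 2 Y \<le> 2 * Y * r" by (simp only: mult_ac)
  have Yc: "Y \<le> Y ^ 3" "Y ^ 2 \<le> Y ^ 3" "1 \<le> Y ^ 3" "1 \<le> Y ^ 4"
    using assms(1) by (simp_all add: self_le_power power_increasing)
  have "body_cost b Y + 1 = 30 * Y ^ 3 + 60 * Y ^ 2 + 60 * Y + 30 * b + 90"
    by (simp add: body_cost_def power2_eq_square power3_eq_cube algebra_simps)
  also have "\<dots> \<le> 150 * Y ^ 3 + 75 * b" using Yc b2 by linarith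
  also have "\<dots> \<le> 150 * (Y ^ 3 * b) + 75 * (Y ^ 3 * b)"
    using mult_le_mono2[of 1 b "Y ^ 3"] mult_le_mono1[of 1 "Y ^ 3" b] Yc b2 by linarith
  also have "\<dots> = 225 * (Y ^ 3 * b)" by simp
  finally have bc: "body_cost b Y + 1 \<le> 225 * (Y ^ 3 * b)" .
  have "visits 2 Y * (body_cost b Y + 1) \<le> (2 * Y * r) * (225 * (Y ^ 3 * b))"
    by (rule mult_le_mono[OF v bc])
  also have "\<dots> = 450 * (Y ^ 4 * b * r)" by (simp add: power4_eq_xxxx power3_eq_cube)
  finally have 1: "visits 2 Y * (body_cost b Y + 1) \<le> 450 * (Y ^ 4 * b * r)" .
  have "1 * b * 1 \<le> Y ^ 4 * b * r" using Yc r by (intro mult_le_mono) simp_all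
  then have 2: "30 * b + 89 \<le> 75 * (Y ^ 4 * b * r)" using b2 by linarith
  from 1 2 have 3: "visits 2 Y * (body_cost b Y + 1) + 30 * b + 89 \<le> 2 ^ 10 * (Y ^ 4 * b * r)"
    by simp
  have "1 \<le> wide b" using b2 by (simp add: wide_def)
  then have "1 + wide b \<le> 2 ^ 30 * b" by (simp add: wide_def)
  then have "(1 + wide b)\<^sup>2 \<le> (2 ^ 30 * b)\<^sup>2" by (rule power_mono) simp
  with 3 have "(visits 2 Y * (body_cost b Y + 1) + 30 * b + 89) * (1 + wide b)\<^sup>2
      \<le> 2 ^ 10 * (Y ^ 4 * b * r) * (2 ^ 30 * b)\<^sup>2"
    by (rule mult_le_mono)
  also have "\<dots> = 2 ^ 70 * (Y ^ 4 * r * b ^ 3)"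
    by (simp add: power_mult_distrib power2_eq_square power3_eq_cube)
  also have "\<dots> \<le> 2 ^ 70 * (Y ^ 4 * r * (8 * (a * Y\<^sup>2)) ^ 3)"
    using b by (intro mult_le_mono2 power_mono) simp_all
  also have "\<dots> = 2 ^ 79 * (a ^ 3 * Y ^ 10 * r)"
    by (simp add: power_mult_distrib flip: power_mult power_add)
  finally show "(visits 2 Y * (body_cost b Y + 1) + 30 * b + 89) * (1 + wide b)\<^sup>2
    \<le> 2 ^ 79 * (a ^ 3 * Y ^ 10 * codes Y)" by (simp only: r_def)
  show "wide b \<le> 2 ^ 32 * (a * Y\<^sup>2)" using b by (simp add: wide_def)
qed

lemma factor_prog_resources:
  assumes "composite N"
  defines "D \<equiv> Delta16 N"
  shows "\<exists>d t n. computes factor_prog N t n d \<and> proper_factor d N \<and>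
     real t \<le> 2 ^ 87 * 196 ^ 13 * (ln (real N) * ln D) ^ 26 *
       (D * exp (- (ln 2 * ln D / log_bound D))) \<and>
     real n \<le> real (card (insert 0 (regs factor_prog))) * 2 ^ 34 * 196\<^sup>2 * (ln (real N) * ln D) ^ 4"
proof -
  let ?s = "isqrt (4 * N - 1) + 1"
  let ?L = "ln (real N)"
  obtain Y m where Y: "2 \<le> Y" "real (primorial (Y - 1)) \<le> D" "m < codes Y"
    and m: "proper_factor (candidate N ?s Y m) N"
    using cutoff_exists[OF assms(1)] unfolding D_def by blast
  define a b where "a = len N" and "b = 2 * (a + Y * Y + 4)"
  have N: "0 < N" using assms(1) by (simp add: composite_def)
  have D: "16 \<le> D" by (simp add: D_def Delta16_def)
  have a: "1 \<le> a" using N floorlog_eq_zero_iff[of 2 N] by (simp add: a_def Suc_le_eq)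
  have "isqrt (4 * N - 1) \<le> (isqrt (4 * N - 1))\<^sup>2" by (simp add: power2_eq_square)
  with isqrt_bounds(1)[of "4 * N - 1"] N have "?s \<le> 4 * N" by linarith
  then have big: "(N + ?s + fact Y + Y + 4)\<^sup>2 < 2 ^ b"
    unfolding b_def a_def using N by (rule bits_suffice)
  obtain d t n where *: "computes factor_prog N t n d" "proper_factor d N"
    "t \<le> (visits 2 Y * (body_cost b Y + 1) + 30 * b + 89) * (1 + wide b)\<^sup>2"
    "n \<le> card (insert 0 (regs factor_prog)) * wide b"
    using computes_factor[OF big m Y(3,1)] by blast
  note L = ln_ge_1[OF assms(1)] and lD = ln_ge_2[OF D]
  let ?G = "D * exp (- (ln 2 * ln D / log_bound D))"
  have G: "0 \<le> ?G" using D by simp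
  have aL: "real a \<le> 4 * ?L" unfolding a_def by (rule len_le_ln[OF assms(1)])
  have YD: "real Y \<le> 196 * (ln D)\<^sup>2" by (rule cutoff_bounds(1)[OF Y(1) D Y(2)])
  have "real t \<le> real (2 ^ 79 * (a ^ 3 * Y ^ 10 * codes Y))"
    unfolding of_nat_le_iff by (rule order_trans[OF *(3) steps_le(1)[OF Y(1) a b_def]])
  also have "\<dots> = 2 ^ 79 * (real a ^ 3 * real Y ^ 10 * real (codes Y))" by simp
  also have "\<dots> \<le> 2 ^ 79 * (real a ^ 3 * real Y ^ 10 * (4 * real Y ^ 3 * ?G))"
    by (intro mult_left_mono codes_bound[OF Y(1) D Y(2)]) simp_all
  also have "\<dots> = 2 ^ 81 * (real a ^ 3 * real Y ^ 13) * ?G" by (simp flip: power_add)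
  also have "\<dots> \<le> 2 ^ 81 * ((4 * ?L) ^ 3 * (196 * (ln D)\<^sup>2) ^ 13) * ?G"
    using G aL YD L by (intro mult_right_mono mult_left_mono mult_mono power_mono) simp_all
  also have "\<dots> = 2 ^ 87 * 196 ^ 13 * (?L ^ 3 * ln D ^ 26) * ?G"
    by (simp add: power_mult_distrib flip: power_mult)
  \<comment> \<open>\<open>soft_O\<close> provides powers of the product of both logarithms; as
    \<open>ln N >= 1\<close>, its exponent may be raised to match.\<close>
  also have "\<dots> \<le> 2 ^ 87 * 196 ^ 13 * (?L ^ 26 * ln D ^ 26) * ?G"
    using G L lD by (intro mult_right_mono mult_left_mono power_increasing) simp_all
  finally have t: "real t \<le> 2 ^ 87 * 196 ^ 13 * (?L * ln D) ^ 26 * ?G"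
    by (simp only: power_mult_distrib)
  let ?c = "card (insert 0 (regs factor_prog))"
  have "n \<le> ?c * (2 ^ 32 * (a * Y\<^sup>2))"
    by (rule order_trans[OF *(4) mult_le_mono2[OF steps_le(2)[OF Y(1) a b_def]]])
  then have "real n \<le> real (?c * (2 ^ 32 * (a * Y\<^sup>2)))" by (simp only: of_nat_le_iff)
  also have "\<dots> = real ?c * 2 ^ 32 * (real a * (real Y)\<^sup>2)" by simp
  also have "\<dots> \<le> real ?c * 2 ^ 32 * ((4 * ?L) * (196 * (ln D)\<^sup>2)\<^sup>2)"
    using aL YD L by (intro mult_left_mono mult_mono power_mono) simp_all
  also have "\<dots> = real ?c * 2 ^ 34 * 196\<^sup>2 * (?L ^ 1 * ln D ^ 4)"
    by (simp add: power_mult_distrib flip: power_mult)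
  also have "\<dots> \<le> real ?c * 2 ^ 34 * 196\<^sup>2 * (?L ^ 4 * ln D ^ 4)"
    using L lD by (intro mult_right_mono mult_left_mono power_increasing) simp_all
  finally have "real n \<le> real ?c * 2 ^ 34 * 196\<^sup>2 * (?L * ln D) ^ 4"
    by (simp only: power_mult_distrib)
  with * t show ?thesis by blast
qed

theorem theorem4p5:
  "\<exists>(P :: prog) (T :: nat \<Rightarrow> nat) (S :: nat \<Rightarrow> nat) (\<epsilon> :: real \<Rightarrow> real).
     (\<forall>N. composite N \<longrightarrow> (\<exists>d. computes P N (T N) (S N) d \<and> proper_factor d N)) \<and>
     \<epsilon> \<in> o[at_top](\<lambda>_. 1) \<and> (\<exists>B. \<forall>x. \<bar>\<epsilon> x\<bar> \<le> B) \<and>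
     soft_O (\<lambda>N. real (T N))
       (\<lambda>N. let D = Delta16 N; C = (1 + \<epsilon> D) * ln 2
             in D * exp (- C * ln D / ln (ln D))) \<and>
     soft_O (\<lambda>N. real (S N)) (\<lambda>N. 1)"
proof -
  \<comment> \<open>Chosen so that \<open>(1 + \<epsilon> D) / ln (ln D) = 1 / log_bound D\<close>
    for \<open>D >= 16\<close>; the value 0 elsewhere keeps \<epsilon> bounded.\<close>
  define \<epsilon> where "\<epsilon> = (\<lambda>D. if 16 \<le> D then ln (ln D) / log_bound D - 1 else 0)"
  obtain d T S where *: "\<And>N. composite N \<Longrightarrow> computes factor_prog N (T N) (S N) (d N)"
    "\<And>N. composite N \<Longrightarrow> proper_factor (d N) N"
    "\<And>N. composite N \<Longrightarrow> real (T N) \<le> 2 ^ 87 * 196 ^ 13 * (ln (real N) * ln (Delta16 N)) ^ 26 *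
       (Delta16 N * exp (- (ln 2 * ln (Delta16 N) / log_bound (Delta16 N))))"
    "\<And>N. composite N \<Longrightarrow> real (S N) \<le> real (card (insert 0 (regs factor_prog))) * 2 ^ 34 * 196\<^sup>2 *
       (ln (real N) * ln (Delta16 N)) ^ 4"
    using factor_prog_resources by metis
  have "((\<lambda>D. ln (ln D) / log_bound D - 1) \<longlongrightarrow> 0) at_top"
    unfolding log_bound_def by real_asymp
  moreover have "\<forall>\<^sub>F D in at_top. \<epsilon> D = ln (ln D) / log_bound D - 1"
    using eventually_ge_at_top[of 16] by eventually_elim (simp add: \<epsilon>_def)
  ultimately have "(\<epsilon> \<longlongrightarrow> 0) at_top" by (simp cong: tendsto_cong)
  then have small: "\<epsilon> \<in> o[at_top](\<lambda>_. 1)" by (intro smalloI_tendsto) simp_all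
  have bounded: "\<bar>\<epsilon> D\<bar> \<le> 1" for D
  proof (cases "16 \<le> D")
    case True
    then have "0 < ln (ln D)" "ln (ln D) \<le> log_bound D"
      using ln_ln_ge[of D] ln_2_ge_half log_bound_ge[of D] by linarith+
    then have "0 \<le> ln (ln D) / log_bound D" "ln (ln D) / log_bound D \<le> 1"
      by (simp_all add: field_simps)
    with True show ?thesis by (simp add: \<epsilon>_def)
  qed (simp add: \<epsilon>_def)
  have exponent: "- ((1 + \<epsilon> D) * ln 2) * ln D / ln (ln D) = - (ln 2 * ln D / log_bound D)"
    if "16 \<le> D" for D
  proof -
    have "0 < ln (ln D)" using ln_ln_ge[OF that] ln_2_ge_half by linarith
    with that show ?thesis by (simp add: \<epsilon>_def field_simps)
  qed
  have D16: "16 \<le> Delta16 N" for N by (simp add: Delta16_def)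
  have "soft_O (\<lambda>N. real (T N)) (\<lambda>N. let D = Delta16 N; C = (1 + \<epsilon> D) * ln 2
             in D * exp (- C * ln D / ln (ln D)))"
    unfolding soft_O_def Let_def exponent[OF D16]
  proof (intro exI allI impI)
    fix N assume N: "composite N"
    have "0 \<le> Delta16 N" using D16[of N] by simp
    then show "\<bar>real (T N)\<bar> \<le> 2 ^ 87 * 196 ^ 13 * (ln (real N) * ln (Delta16 N)) ^ 26 *
        \<bar>Delta16 N * exp (- (ln 2 * ln (Delta16 N) / log_bound (Delta16 N)))\<bar>"
      using *(3)[OF N] by (simp only: abs_mult abs_of_nonneg abs_exp_cancel abs_of_nat)
  qed
  moreover have "soft_O (\<lambda>N. real (S N)) (\<lambda>N. 1)"
    unfolding soft_O_def
  proof (intro exI allI impI)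
    fix N assume "composite N"
    from *(4)[OF this] show "\<bar>real (S N)\<bar> \<le> real (card (insert 0 (regs factor_prog))) * 2 ^ 34 * 196\<^sup>2 *
        (ln (real N) * ln (Delta16 N)) ^ 4 * \<bar>1\<bar>"
      by (simp only: abs_of_nat abs_one mult_1_right)
  qed
  moreover have "\<forall>N. composite N \<longrightarrow> (\<exists>d. computes factor_prog N (T N) (S N) d \<and> proper_factor d N)"
    using *(1,2) by blast
  moreover have "\<exists>B. \<forall>x. \<bar>\<epsilon> x\<bar> \<le> B" using bounded by blast
  ultimately show ?thesis using small by blast
qed

end
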